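(* For every $d\in\mathbb{N}$ there is a constant $c=c(d)<\infty$ such that the following holds. Let $0<\alpha<\tfrac12$, $0<p\le1$, $\ell\in\{1,\dots,d\}$, and let $\mu$ be a measure on $\mathbb{R}^d$. For $\mu$ almost all $x\in P_{\ell,\alpha,p}(\mu)$ we have $$\overline{\dim}_{\mathrm{loc}}(\mu,x)\le d-p\ell+\frac{c}{\log\frac{1}{1-2\alpha}}.$$ Moreover, for $\mu$ almost every $x\in U_{\ell,\alpha,p}(\mu)$ we have $$\underline{\dim}_{\mathrm{loc}}(\mu,x)\le d-p\ell+\frac{c}{\log\frac{1}{1-2\alpha}}.$$
   Context: A measure on $\mathbb{R}^d$ means a Borel regular, locally finite outer measure with compact support. $B(x,r)$ is the closed ball with center $x$ and radius $r$. $[N]=\{1,\dots,N\}$. Logarithms are to base $2$. Local dimensions: $\overline{\dim}_{\mathrm{loc}}(\mu,x)=\limsup_{r\searrow0}\frac{\log\mu(B(x,r))}{\log r}$ and $\underline{\dim}_{\mathrm{loc}}(\mu,x)=\liminf_{r\searrow0}\frac{\log\mu(B(x,r))}{\log r}$. Porosity: for $\ell\in\{1,\dots,d\}$, the $\ell$-porosity of a measure $\mu$ at $x\in\mathbb{R}^d$ with parameters $r,\epsilon>0$ is $$\operatorname{por}_\ell(\mu,x,r,\epsilon)=\sup\{\varrho>0:\ \exists\, y_1,\dots,y_\ell\in\mathbb{R}^d\text{ with }(y_i-x)\cdot(y_j-x)=0\text{ for }i\ne j,\ B(y_i,\varrho r)\subset B(x,r)\text{ and }\mu(B(y_i,\varrho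 r))\le\epsilon\,\mu(B(x,r))\text{ for all }i\}.$$ Mean porosity: let $0<\alpha<1/2$ and $0<p\le1$, and consider the condition $$\operatorname{por}_\ell(\mu,x,2^{-k},\epsilon)>\alpha\quad\text{for at least }pN\text{ values }k\in[N].\qquad(\mathrm{P})$$ The measure $\mu$ is lower mean $(\ell,\alpha,p)$-porous at $x$ if for every $\epsilon>0$, (P) holds for all large enough $N\in\mathbb{N}$ (depending on $\epsilon$ and $x$). It is upper mean $(\ell,\alpha,p)$-porous at $x$ if for every $\epsilon>0$, (P) holds for infinitely many $N\in\mathbb{N}$. $P_{\ell,\alpha,p}(\mu)$ is the set of $x\in\mathbb{R}^d$ at which $\mu$ is lower mean $(\ell,\alpha,p)$-porous, and $U_{\ell,\alpha,p}(\mu)$ is the set of $x\in\mathbb{R}^d$ at which $\mu$ is upper mean $(\ell,\alpha,p)$-porous. *)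

theory Defs
  imports "HOL-Analysis.Analysis"
begin

text \<open>
  Measures are outer measures in the sense of geometric measure theory: they are defined on all
  subsets of the space. Borel regularity says that Borel sets are
  Caratheodory measurable and that every set has a Borel hull of the same measure.
\<close>

definition borel_regular :: "('a::topological_space set \<Rightarrow> ennreal) \<Rightarrow> bool" where
  "borel_regular \<mu> \<longleftrightarrow>
     sets borel \<subseteq> lambda_system UNIV UNIV \<mu> \<and>
     (\<forall>A. \<exists>B \<in> sets borel. A \<subseteq> B \<and> \<mu> B = \<mu> A)"

definition locally_finite :: "('a::metric_space set \<Rightarrow> ennreal) \<Rightarrow> bool" where
  "locally_finite \<mu> \<longleftrightarrow> (\<forall>x. \<exists>r>0. \<mu> (cball x r) < \<infinity>)"

definition msupport :: "('a::metric_space set \<Rightarrow> ennreal) \<Rightarrow> 'a set" where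
  "msupport \<mu> = {x. \<forall>r>0. \<mu> (cball x r) > 0}"

definition gmt_measure :: "('a::euclidean_space set \<Rightarrow> ennreal) \<Rightarrow> bool" where
  "gmt_measure \<mu> \<longleftrightarrow>
     outer_measure_space UNIV \<mu> \<and> borel_regular \<mu> \<and> locally_finite \<mu> \<and> compact (msupport \<mu>)"

text \<open>
  For \<open>0 < r < 1\<close>. A ball of measure zero has \<open>log 0 = -\<infinity>\<close>, so that the quotient is \<open>\<infinity>\<close>; the real
  logarithm would instead give \<open>log 2 0 = 0\<close>. Balls have finite measure under
  \<open>gmt_measure\<close>, so \<open>enn2real\<close> loses nothing.
\<close>

definition loc_dim_quotient :: "('a::metric_space set \<Rightarrow> ennreal) \<Rightarrow> 'a \<Rightarrow> real \<Rightarrow> ereal" where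
  "loc_dim_quotient \<mu> x r =
     (if \<mu> (cball x r) = 0 then \<infinity>
      else ereal (log 2 (enn2real (\<mu> (cball x r))) / log 2 r))"

definition upper_loc_dim :: "('a::metric_space set \<Rightarrow> ennreal) \<Rightarrow> 'a \<Rightarrow> ereal" where
  "upper_loc_dim \<mu> x = Limsup (at_right 0) (loc_dim_quotient \<mu> x)"

definition lower_loc_dim :: "('a::metric_space set \<Rightarrow> ennreal) \<Rightarrow> 'a \<Rightarrow> ereal" where
  "lower_loc_dim \<mu> x = Liminf (at_right 0) (loc_dim_quotient \<mu> x)"

text \<open>The supremum is taken in \<^typ>\<open>ereal\<close>, because \<^term>\<open>Sup {} :: real\<close> is unspecified.\<close>

definition por ::
  "nat \<Rightarrow> ('a::euclidean_space set \<Rightarrow> ennreal) \<Rightarrow> 'a \<Rightarrow> real \<Rightarrow> real \<Rightarrow> ereal" where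
  "por l \<mu> x r \<epsilon> = Sup (ereal ` {\<rho>. \<rho> > 0 \<and> (\<exists>y :: nat \<Rightarrow> 'a.
     (\<forall>i\<in>{1..l}. \<forall>j\<in>{1..l}. i \<noteq> j \<longrightarrow> (y i - x) \<bullet> (y j - x) = 0) \<and>
     (\<forall>i\<in>{1..l}. cball (y i) (\<rho> * r) \<subseteq> cball x r \<and>
                 \<mu> (cball (y i) (\<rho> * r)) \<le> ennreal \<epsilon> * \<mu> (cball x r)))})"

definition mean_porous_upto ::
  "nat \<Rightarrow> real \<Rightarrow> real \<Rightarrow> ('a::euclidean_space set \<Rightarrow> ennreal) \<Rightarrow> 'a \<Rightarrow> real \<Rightarrow> nat \<Rightarrow> bool" where
  "mean_porous_upto l \<alpha> p \<mu> x \<epsilon> N \<longleftrightarrow>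
     real (card {k \<in> {1..N}. por l \<mu> x (1 / 2 ^ k) \<epsilon> > ereal \<alpha>}) \<ge> p * real N"

definition lower_mean_porous_set ::
  "nat \<Rightarrow> real \<Rightarrow> real \<Rightarrow> ('a::euclidean_space set \<Rightarrow> ennreal) \<Rightarrow> 'a set" where
  "lower_mean_porous_set l \<alpha> p \<mu> =
     {x. \<forall>\<epsilon>>0. \<forall>\<^sub>F N in sequentially. mean_porous_upto l \<alpha> p \<mu> x \<epsilon> N}"

definition upper_mean_porous_set ::
  "nat \<Rightarrow> real \<Rightarrow> real \<Rightarrow> ('a::euclidean_space set \<Rightarrow> ennreal) \<Rightarrow> 'a set" where
  "upper_mean_porous_set l \<alpha> p \<mu> =
     {x. \<forall>\<epsilon>>0. \<exists>\<^sub>F N in sequentially. mean_porous_upto l \<alpha> p \<mu> x \<epsilon> N}"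

end

theory Submission
  imports Defs
begin

text \<open>
  Choose \<open>L\<close> with \<open>4\<^sup>-\<^sup>L \<approx> 1 - 2\<alpha>\<close>. If \<open>x\<close> is porous at scale \<open>2\<^sup>-\<^sup>k\<close> and \<open>\<mu>\<close> does not drop too fast around \<open>x\<close>
  between the scales \<open>2\<^sup>1\<^sup>-\<^sup>k\<close> and \<open>2\<^sup>-\<^sup>k\<^sup>-\<^sup>2\<^sup>L\<close>, then \<open>x\<close> cannot lie deep inside any of the \<open>l\<close> holes, so the holes,
  being nearly half as large as the ball, nearly touch \<open>x\<close>. Each point of this kind therefore sees
  the other ones within distance \<open>2\<^sup>-\<^sup>k\<^sup>-\<^sup>L\<close> in \<open>l\<close> orthogonal half-spaces, up to an error \<open>2\<^sup>-\<^sup>k\<^sup>-\<^sup>2\<^sup>L\<close>. Sorting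
  the points into boundedly many classes of directions confines each class to a neighbourhood of a
  Lipschitz graph over \<open>d - l\<close> dimensions, which costs \<open>O(2\<^sup>L\<^sup>(\<^sup>d\<^sup>-\<^sup>l\<^sup>))\<close> instead of \<open>O(2\<^sup>L\<^sup>d)\<close> small pieces.
  Iterating this along a residue class of scales modulo \<open>L\<close> covers the points which are porous at
  \<open>p n\<close> of the first \<open>n\<close> scales by \<open>2\<^sup>n\<^sup>(\<^sup>d \<^sup>- \<^sup>p\<^sup>l \<^sup>+ \<^sup>O\<^sup>(\<^sup>1\<^sup>/\<^sup>L\<^sup>)\<^sup>)\<close> sets of diameter \<open>2\<^sup>-\<^sup>n\<close>. By Borel--Cantelli almost none of
  these points has infinitely many balls whose mass is too small for the claimed dimension.
\<close>

subsection \<open>Covering by sets of small diameter\<close>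

text \<open>A pairwise bound passes to subsets at once and makes sense for unbounded sets, where the
  supremum in \<open>diameter\<close> has no usable value.\<close>

definition diam_le :: "'a::metric_space set \<Rightarrow> real \<Rightarrow> bool" where
  "diam_le S \<rho> \<longleftrightarrow> (\<forall>x\<in>S. \<forall>y\<in>S. dist x y \<le> \<rho>)"

text \<open>A bound on a covering number. M is real so that fractional factors, such as the gain of
  a good scale, can enter directly.\<close>

definition coverable :: "'a::metric_space set \<Rightarrow> real \<Rightarrow> real \<Rightarrow> bool" where
  "coverable S \<rho> M \<longleftrightarrow>
     (\<exists>F. finite F \<and> real (card F) \<le> M \<and> S \<subseteq> \<Union>F \<and> (\<forall>T\<in>F. diam_le T \<rho>))"

lemma diam_le_mono: "diam_le S \<rho> \<Longrightarrow> T \<subseteq> S \<Longrightarrow> \<rho> \<le> \<sigma> \<Longrightarrow> diam_le T \<sigma>"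
  unfolding diam_le_def by (meson order_trans subsetD)

lemma coverable_mono:
  assumes "coverable S \<rho> M" "T \<subseteq> S" "\<rho> \<le> \<sigma>" "M \<le> N"
  shows "coverable T \<sigma> N"
proof -
  obtain F where F: "finite F" "real (card F) \<le> M" "S \<subseteq> \<Union>F" "\<forall>U\<in>F. diam_le U \<rho>"
    using assms(1) unfolding coverable_def by blast
  have "\<forall>U\<in>F. diam_le U \<sigma>"
    using F(4) assms(3) diam_le_mono by blast
  with F assms show ?thesis
    unfolding coverable_def by (intro exI[of _ F]) auto
qed

lemma coverable_single: "diam_le S \<rho> \<Longrightarrow> coverable S \<rho> 1"
  unfolding coverable_def by (intro exI[of _ "{S}"]) auto

lemma coverable_empty: "0 \<le> M \<Longrightarrow> coverable {} \<rho> M"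
  unfolding coverable_def by (intro exI[of _ "{}"]) auto

lemma coverable_UN:
  assumes "finite I" "\<And>i. i \<in> I \<Longrightarrow> coverable (A i) \<rho> M"
  shows "coverable (\<Union>i\<in>I. A i) \<rho> (real (card I) * M)"
proof -
  obtain F where F: "\<And>i. i \<in> I \<Longrightarrow> finite (F i) \<and> real (card (F i)) \<le> M \<and> A i \<subseteq> \<Union>(F i)
      \<and> (\<forall>T\<in>F i. diam_le T \<rho>)"
    using assms(2) unfolding coverable_def by metis
  have "real (card (\<Union>i\<in>I. F i)) \<le> real (\<Sum>i\<in>I. card (F i))"
    using card_UN_le[OF assms(1)] by (simp only: of_nat_le_iff)
  also have "\<dots> \<le> real (card I) * M"
    using F by (simp add: sum_bounded_above)
  finally have "real (card (\<Union>i\<in>I. F i)) \<le> real (card I) * M" .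
  moreover have "finite (\<Union>i\<in>I. F i)" "(\<Union>i\<in>I. A i) \<subseteq> \<Union>(\<Union>i\<in>I. F i)"
    "\<forall>T\<in>(\<Union>i\<in>I. F i). diam_le T \<rho>"
    using F assms(1) by (simp, fastforce, blast)
  ultimately show ?thesis
    unfolding coverable_def by blast
qed

lemma coverable_Un:
  assumes "coverable S \<rho> M" "coverable T \<rho> N"
  shows "coverable (S \<union> T) \<rho> (M + N)"
proof -
  obtain F G where F: "finite F" "real (card F) \<le> M" "S \<subseteq> \<Union>F" "\<forall>U\<in>F. diam_le U \<rho>"
    and G: "finite G" "real (card G) \<le> N" "T \<subseteq> \<Union>G" "\<forall>U\<in>G. diam_le U \<rho>"
    using assms unfolding coverable_def by metis
  have "real (card (F \<union> G)) \<le> M + N"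
    using F(2) G(2) card_Un_le[of F G] by linarith
  with F G show ?thesis
    unfolding coverable_def by (intro exI[of _ "F \<union> G"]) auto
qed

lemma coverable_trans:
  assumes "coverable S \<rho> M" "0 \<le> N"
    and "\<And>T. T \<subseteq> S \<Longrightarrow> diam_le T \<rho> \<Longrightarrow> coverable T \<sigma> N"
  shows "coverable S \<sigma> (M * N)"
proof -
  obtain F where F: "finite F" "real (card F) \<le> M" "S \<subseteq> \<Union>F" "\<forall>U\<in>F. diam_le U \<rho>"
    using assms(1) unfolding coverable_def by blast
  have "coverable (\<Union>U\<in>F. U \<inter> S) \<sigma> (real (card F) * N)"
    using F by (intro coverable_UN assms(3)) (auto intro: diam_le_mono)
  then show ?thesis
    by (rule coverable_mono) (use F assms(2) in \<open>auto intro: mult_right_mono\<close>)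
qed

text \<open>
  The factor 2 per step pays for not knowing which scales are good for a point: at every step the
  set is split into the points for which the scale is good and the others.
\<close>

lemma coverable_tree:
  fixes \<rho> :: "nat \<Rightarrow> real" and S :: "'a::metric_space set"
  assumes "0 \<le> P" "0 \<le> \<kappa>"
    and plain: "\<And>j (T :: 'a set). diam_le T (\<rho> j) \<Longrightarrow> coverable T (\<rho> (Suc j)) P"
    and good: "\<And>j T. diam_le T (\<rho> j) \<Longrightarrow> (\<And>x. x \<in> T \<Longrightarrow> G x j) \<Longrightarrow>
      coverable T (\<rho> (Suc j)) (P * \<kappa>)"
    and S: "coverable S (\<rho> 0) M" "0 \<le> M"
  shows "coverable {x \<in> S. g \<le> card {j. j < J \<and> G x j}} (\<rho> J) (M * (2 * P) ^ J * \<kappa> ^ g)"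
proof (induction J arbitrary: g)
  case 0
  show ?case
  proof (cases "g = 0")
    case False
    then have *: "{x \<in> S. g \<le> card {j. j < 0 \<and> G x j}} = {}" by auto
    show ?thesis unfolding * by (rule coverable_empty) (use assms in auto)
  qed (use S in simp)
next
  case (Suc J)
  let ?E = "\<lambda>J g. {x \<in> S. g \<le> card {j. j < J \<and> G x j}}"
  let ?X = "M * (2 * P) ^ J"
  \<comment> \<open>Points with g good scales already: their pieces are subdivided at the plain
    price P.\<close>
  have c1: "coverable (?E J g) (\<rho> (Suc J)) (?X * \<kappa> ^ g * P)"
    using Suc.IH[of g] assms(1)
  proof (rule coverable_trans)
    fix T :: "'a set" assume "diam_le T (\<rho> J)"
    then show "coverable T (\<rho> (Suc J)) P" by (rule plain)
  qed
  have split: "card {j. j < Suc J \<and> G x j} = card {j. j < J \<and> G x j} + of_bool (G x J)" for x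
  proof -
    have "{j. j < Suc J \<and> G x j} = (if G x J then insert J {j. j < J \<and> G x j} else {j. j < J \<and> G x j})"
      by (auto simp: less_Suc_eq)
    then show ?thesis by simp
  qed
  show ?case
  proof (cases g)
    case 0
    have "coverable (?E (Suc J) g) (\<rho> (Suc J)) (?X * \<kappa> ^ g * P)"
      by (rule coverable_mono[OF c1]) (use 0 in auto)
    then show ?thesis
      by (rule coverable_mono) (use 0 assms in auto)
  next
    case (Suc h)
    \<comment> \<open>With g = h + 1, a point either had g good scales before step J, or had h and
      is good at J. The second kind is one factor \<kappa> behind, which its cheaper subdivision
      makes up for: both bounds are equal and add up to the factor 2 P.\<close>
    have "coverable {x \<in> ?E J h. G x J} (\<rho> J) (?X * \<kappa> ^ h)"
      by (rule coverable_mono[OF Suc.IH[of h]]) auto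
    then have "coverable {x \<in> ?E J h. G x J} (\<rho> (Suc J)) (?X * \<kappa> ^ h * (P * \<kappa>))"
    proof (rule coverable_trans)
      fix T assume "T \<subseteq> {x \<in> ?E J h. G x J}" "diam_le T (\<rho> J)"
      then show "coverable T (\<rho> (Suc J)) (P * \<kappa>)" by (intro good) auto
    qed (use assms(1,2) in simp)
    with c1 have "coverable (?E J g \<union> {x \<in> ?E J h. G x J}) (\<rho> (Suc J))
        (?X * \<kappa> ^ g * P + ?X * \<kappa> ^ h * (P * \<kappa>))"
      by (rule coverable_Un)
    then show ?thesis
      by (rule coverable_mono) (use Suc in \<open>auto simp: split\<close>)
  qed
qed

text \<open>Points are sorted by the integer parts of their coordinates along B, in units of h and
  relative to one point of S. B may span only part of the space: \<open>sep\<close> is where further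
  information on S controls the other directions.\<close>

lemma coverable_grid:
  fixes S :: "'a::euclidean_space set"
  assumes "finite B" "\<And>b. b \<in> B \<Longrightarrow> norm b \<le> 1" "0 < h" "diam_le S \<rho>" "\<rho> \<le> real N * h"
    and sep: "\<And>x y. x \<in> S \<Longrightarrow> y \<in> S \<Longrightarrow> (\<And>b. b \<in> B \<Longrightarrow> \<bar>(x - y) \<bullet> b\<bar> \<le> h) \<Longrightarrow> dist x y \<le> \<sigma>"
  shows "coverable S \<sigma> ((2 * real N + 1) ^ card B)"
proof (cases "S = {}")
  case True
  then show ?thesis by (simp add: coverable_empty)
next
  case False
  then obtain x0 where x0: "x0 \<in> S" by auto
  define f where "f x = restrict (\<lambda>b. \<lfloor>(x - x0) \<bullet> b / h\<rfloor>) B" for x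
  define Z where "Z = PiE B (\<lambda>_. {- int N..int N})"
  have finZ: "finite Z" unfolding Z_def by (intro finite_PiE assms) auto
  have fZ: "f x \<in> Z" if "x \<in> S" for x
  proof -
    have "\<lfloor>(x - x0) \<bullet> b / h\<rfloor> \<in> {- int N..int N}" if b: "b \<in> B" for b
    proof -
      have "\<bar>(x - x0) \<bullet> b\<bar> \<le> norm (x - x0) * norm b" by (rule Cauchy_Schwarz_ineq2)
      also have "\<dots> \<le> norm (x - x0) * 1" by (intro mult_left_mono assms b) auto
      also have "\<dots> \<le> real N * h"
        using assms(4,5) \<open>x \<in> S\<close> x0 unfolding diam_le_def dist_norm by fastforce
      finally have "\<bar>(x - x0) \<bullet> b / h\<bar> \<le> real N"
        using assms(3) by (simp add: divide_simps)
      then show ?thesis unfolding abs_le_iff by (simp add: le_floor_iff floor_le_iff)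
    qed
    then show ?thesis unfolding f_def Z_def by auto
  qed
  have "coverable {x \<in> S. f x = z} \<sigma> 1" for z
  proof (rule coverable_single, unfold diam_le_def, intro ballI)
    fix x y assume xy: "x \<in> {x \<in> S. f x = z}" "y \<in> {x \<in> S. f x = z}"
    show "dist x y \<le> \<sigma>"
    proof (rule sep)
      fix b assume b: "b \<in> B"
      have "f x b = f y b" using xy by auto
      then have "\<lfloor>(x - x0) \<bullet> b / h\<rfloor> = \<lfloor>(y - x0) \<bullet> b / h\<rfloor>" using b by (simp add: f_def)
      then have "\<bar>(x - x0) \<bullet> b / h - (y - x0) \<bullet> b / h\<bar> \<le> 1" by linarith
      also have "(x - x0) \<bullet> b / h - (y - x0) \<bullet> b / h = (x - y) \<bullet> b / h"
        by (simp add: inner_diff_left diff_divide_distrib)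
      finally show "\<bar>(x - y) \<bullet> b\<bar> \<le> h"
        using assms(3) by (simp add: divide_simps)
    qed (use xy in auto)
  qed
  then have "coverable (\<Union>z\<in>Z. {x \<in> S. f x = z}) \<sigma> (real (card Z) * 1)"
    by (intro coverable_UN finZ)
  moreover have "card Z = (2 * N + 1) ^ card B"
  proof -
    have "nat (2 * int N + 1) = 2 * N + 1" by linarith
    then show ?thesis using assms(1) unfolding Z_def by (simp add: card_PiE assms(1) add.commute)
  qed
  ultimately show ?thesis
    by (rule_tac coverable_mono) (use fZ in \<open>auto simp: add.commute\<close>)
qed

lemma coverable_plain:
  fixes S :: "'a::euclidean_space set"
  assumes "diam_le S \<rho>" "0 < \<sigma>" "\<rho> * DIM('a) \<le> real N * \<sigma>"
  shows "coverable S \<sigma> ((2 * real N + 1) ^ DIM('a))"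
proof (rule coverable_grid[of "Basis :: 'a set" "\<sigma> / DIM('a)" S \<rho>])
  show "\<rho> \<le> real N * (\<sigma> / DIM('a))"
    using assms by (simp add: divide_simps)
  fix x y :: 'a
  assume *: "\<And>b. b \<in> Basis \<Longrightarrow> \<bar>(x - y) \<bullet> b\<bar> \<le> \<sigma> / DIM('a)"
  \<comment> \<open>The l1 norm dominates the norm, hence the cell side \<sigma> / d.\<close>
  have "dist x y \<le> (\<Sum>b\<in>Basis. \<bar>(x - y) \<bullet> b\<bar>)"
    unfolding dist_norm by (rule norm_le_l1)
  also have "\<dots> \<le> (\<Sum>b\<in>(Basis::'a set). \<sigma> / DIM('a))"
    by (intro sum_mono *)
  finally show "dist x y \<le> \<sigma>" by simp
qed (use assms in auto)

text \<open>The crude bound with the full dimension. It supplies the starting cover of the tree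
  argument and controls the points whose balls decay too fast for \<open>DIM('a)\<close>.\<close>

lemma coverable_cball:
  "\<exists>M\<ge>0. \<forall>n. coverable (cball (0::'a::euclidean_space) R) (1 / 2 ^ n) (M * 2 ^ (n * DIM('a)))"
proof -
  let ?d = "DIM('a)"
  obtain N :: nat where N: "2 * R * ?d \<le> N" using real_arch_simple by blast
  have "coverable (cball (0::'a) R) (1 / 2 ^ n) ((2 * real N + 1) ^ ?d * 2 ^ (n * ?d))" for n
  proof (rule coverable_mono)
    have "diam_le (cball (0::'a) R) (2 * R)"
      unfolding diam_le_def
    proof (intro ballI)
      fix x y :: 'a assume "x \<in> cball 0 R" "y \<in> cball 0 R"
      then show "dist x y \<le> 2 * R" using norm_triangle_ineq4[of x y] by (simp add: dist_norm)
    qed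
    then show "coverable (cball (0::'a) R) (1 / 2 ^ n) ((2 * real (N * 2 ^ n) + 1) ^ ?d)"
      by (rule coverable_plain) (use N in auto)
    have "2 * real (N * 2 ^ n) + 1 \<le> (2 * real N + 1) * 2 ^ n" by (simp add: distrib_right)
    then have "(2 * real (N * 2 ^ n) + 1) ^ ?d \<le> ((2 * real N + 1) * 2 ^ n) ^ ?d"
      by (intro power_mono) auto
    then show "(2 * real (N * 2 ^ n) + 1) ^ ?d \<le> (2 * real N + 1) ^ ?d * 2 ^ (n * ?d)"
      by (simp add: power_mult_distrib power_mult)
  qed auto
  then show ?thesis by (intro exI[of _ "(2 * real N + 1) ^ ?d"]) auto
qed

text \<open>B is an orthonormal basis of the orthogonal complement of the frame. The norm is bounded
  by an l1 sum so that frame directions and free directions can be estimated separately.\<close>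

lemma orthonormal_complement:
  fixes e :: "nat \<Rightarrow> 'a::euclidean_space"
  assumes unit: "\<And>i. i \<in> {1..l} \<Longrightarrow> norm (e i) = 1"
    and orth: "\<And>i j. i \<in> {1..l} \<Longrightarrow> j \<in> {1..l} \<Longrightarrow> i \<noteq> j \<Longrightarrow> e i \<bullet> e j = 0"
  obtains B where "finite B" "card B + l = DIM('a)" "\<And>b. b \<in> B \<Longrightarrow> norm b = 1"
    "\<And>v. norm v \<le> (\<Sum>i=1..l. \<bar>v \<bullet> e i\<bar>) + (\<Sum>b\<in>B. \<bar>v \<bullet> b\<bar>)"
proof -
  have inj: "inj_on e {1..l}"
  proof (rule inj_onI, rule ccontr)
    fix i j assume "i \<in> {1..l}" "j \<in> {1..l}" "e i = e j" "i \<noteq> j"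
    then show False using orth[of i j] unit[of j] by (simp add: norm_eq_1)
  qed
  define W where "W = e ` {1..l}"
  have cardW: "card W = l" unfolding W_def using inj by (simp add: card_image)
  have pW: "pairwise orthogonal W"
    unfolding W_def pairwise_def orthogonal_def
  proof (intro ballI impI)
    fix x y assume "x \<in> e ` {1..l}" "y \<in> e ` {1..l}" "x \<noteq> y"
    then obtain i j where "i \<in> {1..l}" "j \<in> {1..l}" "x = e i" "y = e j" by blast
    with \<open>x \<noteq> y\<close> orth[of i j] show "x \<bullet> y = 0" by auto
  qed
  have "0 \<notin> W" unfolding W_def using unit by force
  then have "independent W" by (rule pairwise_orthogonal_independent[OF pW])
  then have dimW: "dim (span W) = l" using cardW by (simp add: dim_eq_card_independent)
  define V where "V = {y. \<forall>x\<in>span W. orthogonal x y}"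
  have subV: "subspace V" unfolding V_def by (rule subspace_orthogonal_to_vectors)
  have dimV: "dim V + l = DIM('a)"
    using dim_subspace_orthogonal_to_vectors[of "span W" UNIV] dimW
    by (simp only: V_def UNIV_I simp_thms dim_UNIV subspace_span subspace_UNIV subset_UNIV)
  obtain B where B: "B \<subseteq> V" "pairwise orthogonal B" "\<And>x. x \<in> B \<Longrightarrow> norm x = 1"
    "independent B" "card B = dim V" "span B = V"
    using orthonormal_basis_subspace[OF subV] by metis
  have finB: "finite B" using B(4) by (rule independent_imp_finite)
  have BW: "b \<bullet> e i = 0" if "b \<in> B" "i \<in> {1..l}" for b i
  proof -
    have "e i \<in> span W" using that by (auto simp: W_def intro: span_base)
    then show ?thesis using B(1) that unfolding V_def orthogonal_def by (auto simp: inner_commute)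
  qed
  have BB: "b \<bullet> b' = of_bool (b = b')" if "b \<in> B" "b' \<in> B" for b b'
    using B(2,3) that by (auto simp: pairwise_def orthogonal_def norm_eq_1)
  have EE: "e i \<bullet> e j = of_bool (i = j)" if "i \<in> {1..l}" "j \<in> {1..l}" for i j
    using unit orth that by (auto simp: norm_eq_1)
  have "norm v \<le> (\<Sum>i=1..l. \<bar>v \<bullet> e i\<bar>) + (\<Sum>b\<in>B. \<bar>v \<bullet> b\<bar>)" for v
  proof -
    define s t where "s = (\<Sum>i=1..l. (v \<bullet> e i) *\<^sub>R e i)" and "t = (\<Sum>b\<in>B. (v \<bullet> b) *\<^sub>R b)"
    \<comment> \<open>The remainder after both projections: being orthogonal to the frame it lies in
      \<open>V = span B\<close>, and being orthogonal to B it is then orthogonal to itself.\<close>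
    define u where "u = v - s - t"
    have "u \<bullet> e j = 0" if j: "j \<in> {1..l}" for j
    proof -
      have "s \<bullet> e j = (\<Sum>i=1..l. if i = j then v \<bullet> e i else 0)"
        unfolding s_def inner_sum_left by (intro sum.cong) (use EE j in auto)
      also have "\<dots> = v \<bullet> e j" using j by simp
      finally have "s \<bullet> e j = v \<bullet> e j" .
      moreover have "t \<bullet> e j = 0"
        unfolding t_def inner_sum_left by (intro sum.neutral) (use BW j in auto)
      ultimately show ?thesis by (simp add: u_def inner_diff_left)
    qed
    then have uV: "u \<in> V"
    proof -
      assume *: "\<And>j. j \<in> {1..l} \<Longrightarrow> u \<bullet> e j = 0"
      have "orthogonal u x" if "x \<in> span W" for x
        using that by (rule orthogonal_to_span) (use * in \<open>auto simp: W_def orthogonal_def\<close>)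
      then show ?thesis by (auto simp: V_def orthogonal_commute)
    qed
    have "u \<bullet> b = 0" if b: "b \<in> B" for b
    proof -
      have "t \<bullet> b = (\<Sum>b'\<in>B. if b' = b then v \<bullet> b' else 0)"
        unfolding t_def inner_sum_left by (intro sum.cong) (use BB b in auto)
      also have "\<dots> = v \<bullet> b" using b finB by simp
      finally have "t \<bullet> b = v \<bullet> b" .
      moreover have "s \<bullet> b = 0"
        unfolding s_def inner_sum_left
        by (intro sum.neutral) (use BW b in \<open>auto simp: inner_commute\<close>)
      ultimately show ?thesis by (simp add: u_def inner_diff_left)
    qed
    then have "orthogonal u x" if "x \<in> span B" for x
      using orthogonal_to_span[OF that] \<open>\<And>b. b \<in> B \<Longrightarrow> u \<bullet> b = 0\<close>
      by (simp add: orthogonal_def)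
    then have "orthogonal u u" using uV B(6) by blast
    then have "u = 0" by (simp add: orthogonal_def)
    then have "s + t = v" by (simp add: u_def diff_diff_eq)
    then have "norm v \<le> norm s + norm t" using norm_triangle_ineq[of s t] by simp
    also have "norm s \<le> (\<Sum>i=1..l. \<bar>v \<bullet> e i\<bar>)"
      unfolding s_def by (rule sum_norm_le) (use unit in auto)
    also have "norm t \<le> (\<Sum>b\<in>B. \<bar>v \<bullet> b\<bar>)"
      unfolding t_def by (rule sum_norm_le) (use B(3) in auto)
    finally show ?thesis by simp
  qed
  moreover have "card B + l = DIM('a)" using B(5) dimV by simp
  ultimately show ?thesis using finB B(3) that by blast
qed

subsection \<open>The geometry of a porous scale\<close>

text \<open>
  Applying the one-sided bound to both points of a pair, with almost the same direction, makes it
  two-sided; only the \<open>d - l\<close> directions orthogonal to a reference frame remain free.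
\<close>

lemma coverable_slab:
  fixes S :: "'a::euclidean_space set" and e :: "'a \<Rightarrow> nat \<Rightarrow> 'a" and \<sigma> :: real
  assumes "0 < \<sigma>" "diam_le S (real N * \<sigma>)"
    and unit: "\<And>x i. x \<in> S \<Longrightarrow> i \<in> {1..l} \<Longrightarrow> norm (e x i) = 1"
    and orth: "\<And>x i j. x \<in> S \<Longrightarrow> i \<in> {1..l} \<Longrightarrow> j \<in> {1..l} \<Longrightarrow> i \<noteq> j \<Longrightarrow> e x i \<bullet> e x j = 0"
    and side: "\<And>x y i. x \<in> S \<Longrightarrow> y \<in> S \<Longrightarrow> i \<in> {1..l} \<Longrightarrow> (y - x) \<bullet> e x i \<le> 6 * \<sigma>"
    and close: "\<And>x y i. x \<in> S \<Longrightarrow> y \<in> S \<Longrightarrow> i \<in> {1..l} \<Longrightarrow> norm (e x i - e y i) \<le> 1 / (2 * DIM('a))"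
  shows "coverable S (14 * DIM('a) * \<sigma>) ((2 * real N + 1) ^ (DIM('a) - l))"
proof (cases "S = {}")
  case True
  then show ?thesis by (simp add: coverable_empty)
next
  case False
  then obtain z where z: "z \<in> S" by auto
  obtain B where B: "finite B" "card B + l = DIM('a)" "\<And>b. b \<in> B \<Longrightarrow> norm b = 1"
    "\<And>v. norm v \<le> (\<Sum>i=1..l. \<bar>v \<bullet> e z i\<bar>) + (\<Sum>b\<in>B. \<bar>v \<bullet> b\<bar>)"
    using orthonormal_complement[of l "e z"] unit[OF z] orth[OF z] by metis
  have "coverable S (14 * DIM('a) * \<sigma>) ((2 * real N + 1) ^ card B)"
  proof (rule coverable_grid[OF B(1) _ assms(1,2) order_refl])
    fix x y assume x: "x \<in> S" and y: "y \<in> S"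
      and *: "\<And>b. b \<in> B \<Longrightarrow> \<bar>(x - y) \<bullet> b\<bar> \<le> \<sigma>"
    define v where "v = x - y"
    have e: "\<bar>v \<bullet> e z i\<bar> \<le> 6 * \<sigma> + norm v / (2 * DIM('a))" if i: "i \<in> {1..l}" for i
    proof -
      have near: "\<bar>v \<bullet> (e z i - e w i)\<bar> \<le> norm v / (2 * DIM('a))" if "w \<in> S" for w
      proof -
        have "\<bar>v \<bullet> (e z i - e w i)\<bar> \<le> norm v * norm (e z i - e w i)"
          by (rule Cauchy_Schwarz_ineq2)
        also have "\<dots> \<le> norm v * (1 / (2 * DIM('a)))"
          by (intro mult_left_mono close z that i) auto
        finally show ?thesis by simp
      qed
      have "v \<bullet> e y i \<le> 6 * \<sigma>" "- (v \<bullet> e x i) \<le> 6 * \<sigma>"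
        using side[OF y x i] side[OF x y i] by (simp_all add: v_def inner_diff_left)
      then show ?thesis
        using near[OF x] near[OF y] by (simp add: inner_diff_right abs_le_iff)
    qed
    have "norm v \<le> (\<Sum>i=1..l. \<bar>v \<bullet> e z i\<bar>) + (\<Sum>b\<in>B. \<bar>v \<bullet> b\<bar>)" by (rule B(4))
    also have "(\<Sum>i=1..l. \<bar>v \<bullet> e z i\<bar>) \<le> of_nat (card {1..l}) * (6 * \<sigma> + norm v / (2 * DIM('a)))"
      by (intro sum_bounded_above e) auto
    also have "(\<Sum>b\<in>B. \<bar>v \<bullet> b\<bar>) \<le> of_nat (card B) * \<sigma>"
      using * by (intro sum_bounded_above) (simp add: v_def)
    also have "real (card {1..l}) * (6 * \<sigma> + norm v / (2 * DIM('a)))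
        \<le> DIM('a) * (6 * \<sigma> + norm v / (2 * DIM('a)))"
      using B(2) assms(1) by (intro mult_right_mono) auto
    also have "real (card B) * \<sigma> \<le> DIM('a) * \<sigma>"
      using B(2) assms(1) by (intro mult_right_mono) auto
    also have "DIM('a) * (6 * \<sigma> + norm v / (2 * DIM('a))) + DIM('a) * \<sigma> = 7 * DIM('a) * \<sigma> + norm v / 2"
      by (simp add: field_simps)
    \<comment> \<open>The tolerance 1 / (2 d) on the directions costs at most half of
      \<open>norm v\<close>, which moves to the left: 14 = 2 * (6 + 1).\<close>
    finally show "dist x y \<le> 14 * DIM('a) * \<sigma>"
      by (simp add: v_def dist_norm)
  qed (use B(3) in auto)
  moreover have "card B = DIM('a) - l" using B(2) by linarith
  ultimately show ?thesis by simp
qed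

text \<open>
  The first factor counts direction classes, the second one the cells of the grid in \<open>d - l\<close>
  dimensions, and the last one the pieces needed to shrink the diameter from \<open>14 d \<sigma>\<close> to \<open>\<sigma>\<close>.
\<close>

definition dir_const :: "nat \<Rightarrow> real" where
  "dir_const d = real ((8 * d\<^sup>2 + 1) ^ (d * d)) * 3 ^ d * real ((28 * d\<^sup>2 + 1) ^ d)"

text \<open>Pigeonhole on directions: the unit sphere is cut into pieces of diameter 1 / (2 d), and
  points are grouped by the pieces containing their l directions. Within a group the frames are as
  close as \<open>coverable_slab\<close> asks, and the number of groups depends on neither N nor
  \<sigma>.\<close>

lemma coverable_directions:
  fixes S :: "'a::euclidean_space set" and e :: "'a \<Rightarrow> nat \<Rightarrow> 'a" and \<sigma> :: real
  assumes "0 < \<sigma>" "diam_le S (real N * \<sigma>)" "1 \<le> N" "l \<le> DIM('a)"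
    and unit: "\<And>x i. x \<in> S \<Longrightarrow> i \<in> {1..l} \<Longrightarrow> norm (e x i) = 1"
    and orth: "\<And>x i j. x \<in> S \<Longrightarrow> i \<in> {1..l} \<Longrightarrow> j \<in> {1..l} \<Longrightarrow> i \<noteq> j \<Longrightarrow> e x i \<bullet> e x j = 0"
    and side: "\<And>x y i. x \<in> S \<Longrightarrow> y \<in> S \<Longrightarrow> i \<in> {1..l} \<Longrightarrow> (y - x) \<bullet> e x i \<le> 6 * \<sigma>"
  shows "coverable S \<sigma> (dir_const DIM('a) * real N ^ (DIM('a) - l))"
proof -
  let ?d = "DIM('a)"
  have "diam_le (sphere (0::'a) 1) 2"
    unfolding diam_le_def
  proof (intro ballI)
    fix x y :: 'a assume "x \<in> sphere 0 1" "y \<in> sphere 0 1"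
    then show "dist x y \<le> 2" using norm_triangle_ineq4[of x y] by (simp add: dist_norm)
  qed
  \<comment> \<open>\<open>coverable_plain\<close> asks for 2 d \<le> N / (2 d), whence N = 4
    d^2.\<close>
  then have "coverable (sphere (0::'a) 1) (1 / (2 * ?d)) ((2 * real (4 * ?d\<^sup>2) + 1) ^ ?d)"
    by (rule coverable_plain) (auto simp: power2_eq_square)
  then obtain F where F: "finite F" "real (card F) \<le> (2 * real (4 * ?d\<^sup>2) + 1) ^ ?d"
    "sphere (0::'a) 1 \<subseteq> \<Union>F" "\<forall>U\<in>F. diam_le U (1 / (2 * ?d))"
    unfolding coverable_def by blast
  define Z where "Z = PiE {1..l} (\<lambda>_. F)"
  have finZ: "finite Z" unfolding Z_def using F(1) by (intro finite_PiE) auto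
  define A where "A c = {x \<in> S. \<forall>i\<in>{1..l}. e x i \<in> c i}" for c
  have sub: "S \<subseteq> (\<Union>c\<in>Z. A c)"
  proof
    fix x assume x: "x \<in> S"
    have "\<exists>U\<in>F. e x i \<in> U" if "i \<in> {1..l}" for i
      using F(3) unit[OF x that] by auto
    then obtain c where c: "\<And>i. i \<in> {1..l} \<Longrightarrow> c i \<in> F \<and> e x i \<in> c i"
      by metis
    then have "restrict c {1..l} \<in> Z" "x \<in> A (restrict c {1..l})"
      using x by (auto simp: Z_def A_def)
    then show "x \<in> (\<Union>c\<in>Z. A c)" by blast
  qed
  let ?M = "(2 * real N + 1) ^ (?d - l) * (2 * real (14 * ?d\<^sup>2) + 1) ^ ?d"
  have "coverable (A c) \<sigma> ?M" if c: "c \<in> Z" for c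
  proof (rule coverable_trans)
    show "coverable (A c) (14 * ?d * \<sigma>) ((2 * real N + 1) ^ (?d - l))"
    proof (rule coverable_slab[where e = e and l = l])
      show "diam_le (A c) (real N * \<sigma>)"
        by (rule diam_le_mono[OF assms(2)]) (auto simp: A_def)
      fix x y i assume "x \<in> A c" "y \<in> A c" "i \<in> {1..l}"
      moreover from this c have "diam_le (c i) (1 / (2 * ?d))"
        using F(4) by (auto simp: Z_def)
      ultimately show "norm (e x i - e y i) \<le> 1 / (2 * DIM('a))"
        by (auto simp: A_def diam_le_def dist_norm)
    next
      fix x y i assume "x \<in> A c" "y \<in> A c" "i \<in> {1..l}"
      then show "(y - x) \<bullet> e x i \<le> 6 * \<sigma>" by (intro side) (auto simp: A_def)
    next
      fix x i assume "x \<in> A c" "i \<in> {1..l}"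
      then show "norm (e x i) = 1" by (intro unit) (auto simp: A_def)
    next
      fix x i j assume "x \<in> A c" "i \<in> {1..l}" "j \<in> {1..l}" "i \<noteq> j"
      then show "e x i \<bullet> e x j = 0" by (intro orth) (auto simp: A_def)
    qed fact
    show "0 \<le> (2 * real (14 * ?d\<^sup>2) + 1) ^ ?d" by simp
    show "coverable T \<sigma> ((2 * real (14 * ?d\<^sup>2) + 1) ^ ?d)"
      if "diam_le T (14 * ?d * \<sigma>)" for T :: "'a set"
      using that assms(1) by (rule coverable_plain) (simp add: power2_eq_square)
  qed
  then have "coverable (\<Union>c\<in>Z. A c) \<sigma> (real (card Z) * ?M)"
    by (intro coverable_UN finZ)
  then show ?thesis
  proof (rule coverable_mono[OF _ sub order_refl])
    have "real (card Z) = real (card F) ^ l" unfolding Z_def by (simp add: card_PiE)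
    also have "\<dots> \<le> ((2 * real (4 * ?d\<^sup>2) + 1) ^ ?d) ^ l"
      by (intro power_mono F(2)) auto
    also have "\<dots> \<le> ((2 * real (4 * ?d\<^sup>2) + 1) ^ ?d) ^ ?d"
      by (intro power_increasing assms one_le_power) auto
    finally have Z: "real (card Z) \<le> real ((8 * ?d\<^sup>2 + 1) ^ (?d * ?d))"
      by (simp add: power_mult add.commute)
    have "(2 * real N + 1) ^ (?d - l) \<le> (3 * real N) ^ (?d - l)"
      using assms(3) by (intro power_mono) auto
    also have "\<dots> \<le> 3 ^ ?d * real N ^ (?d - l)"
      unfolding power_mult_distrib by (intro mult_right_mono power_increasing) auto
    finally have M: "(2 * real N + 1) ^ (?d - l) \<le> 3 ^ ?d * real N ^ (?d - l)" .
    have "real (card Z) * ?M \<le> real ((8 * ?d\<^sup>2 + 1) ^ (?d * ?d)) *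
        ((3 ^ ?d * real N ^ (?d - l)) * (2 * real (14 * ?d\<^sup>2) + 1) ^ ?d)"
      by (intro mult_mono Z M) auto
    also have "\<dots> = dir_const ?d * real N ^ (?d - l)"
      by (simp add: dir_const_def mult_ac add.commute)
    finally show "real (card Z) * ?M \<le> dir_const ?d * real N ^ (?d - l)" .
  qed
qed

text \<open>Both x and z avoid a ball around y whose radius is almost the distance from y to x. In
  the law of cosines for \<open>z - y\<close>, the squares of the inner and outer radius differ by
  O(h r^2), the same order as the square of \<open>z - x\<close>. This balance is why points within
  sqrt h * r of x obey a bound of order h r.\<close>

lemma inner_le_of_avoids_ball:
  fixes x y z :: "'a::real_inner"
  assumes "0 < r" "0 \<le> h" "h \<le> 1 / 16" and t: "t = norm (y - x)"
    and "(1 - 3 * h) / 2 * r \<le> t" "t \<le> (1 + h) / 2 * r"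
    and "(1 - 3 * h) / 2 * r \<le> norm (z - y)" "(norm (z - x))\<^sup>2 \<le> h * r\<^sup>2"
  shows "(z - x) \<bullet> ((1 / t) *\<^sub>R (y - x)) \<le> 6 * (h * r)"
proof -
  \<comment> \<open>h \<le> 1/16 makes 1 - 3 h at least 13/16.\<close>
  have tr: "13 / 32 * r \<le> t"
  proof -
    have "13 / 32 * r \<le> (1 - 3 * h) / 2 * r" using assms by (intro mult_right_mono) auto
    then show ?thesis using assms by linarith
  qed
  then have "0 < t" using assms(1) by linarith
  have "((1 - 3 * h) / 2 * r)\<^sup>2 \<le> (norm (z - y))\<^sup>2"
    using assms by (intro power_mono) auto
  also have "(norm (z - y))\<^sup>2 = (norm (z - x))\<^sup>2 - 2 * ((z - x) \<bullet> (y - x)) + t\<^sup>2"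
    unfolding t power2_norm_eq_inner by (simp add: inner_diff_left inner_diff_right inner_commute)
  also have "t\<^sup>2 \<le> ((1 + h) / 2 * r)\<^sup>2"
    using assms \<open>0 < t\<close> by (intro power_mono) auto
  finally have "2 * ((z - x) \<bullet> (y - x)) \<le> h * r\<^sup>2 + ((1 + h) / 2 * r)\<^sup>2 - ((1 - 3 * h) / 2 * r)\<^sup>2"
    using assms(8) by linarith
  \<comment> \<open>The squares of the two radii differ by (2 h - 2 h^2) r^2; the square of
    \<open>norm (z - x)\<close> adds another h r^2.\<close>
  also have "\<dots> = 3 * h * r\<^sup>2 - 2 * (h * r)\<^sup>2"
    by (simp add: power2_eq_square field_simps)
  also have "\<dots> \<le> 3 * h * r\<^sup>2" by simp
  finally have "2 * ((z - x) \<bullet> (y - x)) \<le> 3 * h * r\<^sup>2" .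
  moreover have "3 * h * r\<^sup>2 \<le> 12 * (h * r) * t"
  proof -
    have "(h * r) * (3 * r) \<le> (h * r) * (12 * t)"
      using tr assms(1,2) by (intro mult_left_mono) auto
    then show ?thesis by (simp add: power2_eq_square mult_ac)
  qed
  ultimately have "(z - x) \<bullet> (y - x) \<le> 6 * (h * r) * t" by linarith
  then have "(z - x) \<bullet> (y - x) / t \<le> 6 * (h * r)"
    using \<open>0 < t\<close> by (simp add: pos_divide_le_eq)
  then show ?thesis by simp
qed

text \<open>
  The second condition excludes that the ball around \<open>x\<close> of radius \<open>2\<^sup>-\<^sup>k\<^sup>-\<^sup>2\<^sup>L\<close> is contained in a hole of
  the measure at scale \<open>2\<^sup>-\<^sup>k\<close>, even in one that is seen from another point at distance at most \<open>2\<^sup>-\<^sup>k\<close>.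
\<close>

definition good_scale ::
  "nat \<Rightarrow> real \<Rightarrow> ('a::euclidean_space set \<Rightarrow> ennreal) \<Rightarrow> real \<Rightarrow> nat \<Rightarrow> 'a \<Rightarrow> nat \<Rightarrow> bool" where
  "good_scale l \<alpha> \<mu> \<epsilon> L x k \<longleftrightarrow> ereal \<alpha> < por l \<mu> x (1 / 2 ^ k) \<epsilon> \<and>
     ennreal \<epsilon> * \<mu> (cball x (2 / 2 ^ k)) < \<mu> (cball x (1 / 2 ^ (k + 2 * L)))"

text \<open>The e i point from x to the centres of the holes. With h = 4^-L, a hole of relative
  radius \<rho> > \<alpha> \<ge> (1 - h) / 2 has its centre within (1 + h) / 2 * r of x, while
  goodness keeps x and all nearby good points out of its core of radius (1 - 3 h) / 2 * r.\<close>

lemma good_scale_directions: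
  fixes \<mu> :: "'a::euclidean_space set \<Rightarrow> ennreal"
  assumes mono: "\<And>A B. A \<subseteq> B \<Longrightarrow> \<mu> A \<le> \<mu> B"
    and L: "2 \<le> L" "1 - 2 * \<alpha> \<le> 1 / 4 ^ L" and x: "good_scale l \<alpha> \<mu> \<epsilon> L x k"
  obtains e :: "nat \<Rightarrow> 'a" where "\<And>i. i \<in> {1..l} \<Longrightarrow> norm (e i) = 1"
    "\<And>i j. i \<in> {1..l} \<Longrightarrow> j \<in> {1..l} \<Longrightarrow> i \<noteq> j \<Longrightarrow> e i \<bullet> e j = 0"
    "\<And>z i. good_scale l \<alpha> \<mu> \<epsilon> L z k \<Longrightarrow> dist x z \<le> 1 / 2 ^ (k + L) \<Longrightarrow> i \<in> {1..l} \<Longrightarrow>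
       (z - x) \<bullet> e i \<le> 6 * (1 / 2 ^ (k + 2 * L))"
proof -
  define r h :: real where "r = 1 / 2 ^ k" and "h = 1 / 4 ^ L"
  have r: "0 < r" by (simp add: r_def)
  have h0: "0 < h" by (simp add: h_def)
  have "(4::real) ^ 2 \<le> 4 ^ L" using L by (intro power_increasing) auto
  then have h16: "h \<le> 1 / 16" unfolding h_def by (simp add: field_simps)
  have four: "(2::real) ^ (2 * L) = 4 ^ L" by (simp add: power_mult)
  have hr: "1 / 2 ^ (k + 2 * L) = h * r" by (simp add: h_def r_def power_add four)
  obtain \<rho> y where \<rho>: "\<alpha> < \<rho>" "0 < \<rho>"
    and orth: "\<forall>i\<in>{1..l}. \<forall>j\<in>{1..l}. i \<noteq> j \<longrightarrow> (y i - x) \<bullet> (y j - x) = 0"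
    and y: "\<forall>i\<in>{1..l}. cball (y i) (\<rho> * r) \<subseteq> cball x r \<and>
                 \<mu> (cball (y i) (\<rho> * r)) \<le> ennreal \<epsilon> * \<mu> (cball x r)"
    using x unfolding good_scale_def por_def less_Sup_iff r_def by auto
  have \<alpha>h: "(1 - 3 * h) / 2 * r \<le> (\<rho> - h) * r" "(1 - \<rho>) * r \<le> (1 + h) / 2 * r"
    using \<rho> L(2) r by (intro mult_right_mono; simp add: h_def)+
  have away: "(1 - 3 * h) / 2 * r \<le> norm (z - y i)"
    if z: "good_scale l \<alpha> \<mu> \<epsilon> L z k" "dist x z \<le> r" and i: "i \<in> {1..l}" for z i
  proof -
    \<comment> \<open>The mass of the hole gets compared with a ball around z instead of x; this is
      the reason for the radius \<open>2 / 2 ^ k\<close> in \<open>good_scale\<close>.\<close>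
    have "cball x r \<subseteq> cball z (2 * r)"
      using z(2) by (auto simp: cball_subset_cball_iff dist_commute)
    have "\<mu> (cball (y i) (\<rho> * r)) \<le> ennreal \<epsilon> * \<mu> (cball x r)" using y i by auto
    also have "\<dots> \<le> ennreal \<epsilon> * \<mu> (cball z (2 * r))"
      using mono[OF \<open>cball x r \<subseteq> cball z (2 * r)\<close>] by (intro mult_left_mono) auto
    also have "\<dots> < \<mu> (cball z (h * r))"
      using z(1) unfolding good_scale_def hr[symmetric] by (simp add: r_def)
    finally have "\<not> cball z (h * r) \<subseteq> cball (y i) (\<rho> * r)"
      using mono leD by blast
    then have "(\<rho> - h) * r \<le> dist z (y i)"
      unfolding cball_subset_cball_iff by (auto simp: algebra_simps)
    then show ?thesis using \<alpha>h by (simp add: dist_norm)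
  qed
  have tle: "norm (y i - x) \<le> (1 + h) / 2 * r" if "i \<in> {1..l}" for i
  proof -
    have "cball (y i) (\<rho> * r) \<subseteq> cball x r" using y that by auto
    then have "norm (y i - x) \<le> (1 - \<rho>) * r"
      using \<rho>(2) r by (auto simp: cball_subset_cball_iff dist_norm algebra_simps mult_less_0_iff)
    then show ?thesis using \<alpha>h by linarith
  qed
  \<comment> \<open>x is itself a good point, at distance 0.\<close>
  have tge: "(1 - 3 * h) / 2 * r \<le> norm (y i - x)" if "i \<in> {1..l}" for i
    using away[OF x _ that] r by (simp add: norm_minus_commute)
  have tpos: "0 < norm (y i - x)" if "i \<in> {1..l}" for i
  proof -
    have "0 < (1 - 3 * h) / 2 * r" using h16 r by (intro mult_pos_pos) auto
    then show ?thesis using tge[OF that] by linarith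
  qed
  define e where "e i = (1 / norm (y i - x)) *\<^sub>R (y i - x)" for i
  show ?thesis
  proof (rule that[of e])
    fix i assume "i \<in> {1..l}"
    then show "norm (e i) = 1" using tpos[of i] by (simp add: e_def)
  next
    fix i j assume "i \<in> {1..l}" "j \<in> {1..l}" "i \<noteq> j"
    then show "e i \<bullet> e j = 0" using orth by (auto simp: e_def)
  next
    fix z i assume z: "good_scale l \<alpha> \<mu> \<epsilon> L z k" "dist x z \<le> 1 / 2 ^ (k + L)" and i: "i \<in> {1..l}"
    have "(1::real) \<le> 2 ^ L" by simp
    then have "1 / 2 ^ (k + L) \<le> r" unfolding r_def by (simp add: power_add divide_simps)
    then have zr: "dist x z \<le> r" using z(2) by linarith
    \<comment> \<open>The distance 2^-(k+L) equals sqrt h * r.\<close>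
    have "(norm (z - x))\<^sup>2 \<le> (1 / 2 ^ (k + L))\<^sup>2"
      using z(2) by (intro power_mono) (auto simp: dist_norm norm_minus_commute)
    also have "\<dots> = h * r\<^sup>2"
      by (simp add: h_def r_def power_add power_mult_distrib power_divide four[symmetric] mult.commute
          flip: power_mult)
    finally have sq: "(norm (z - x))\<^sup>2 \<le> h * r\<^sup>2" .
    show "(z - x) \<bullet> e i \<le> 6 * (1 / 2 ^ (k + 2 * L))"
      unfolding e_def hr
      by (rule inner_le_of_avoids_ball[OF r _ h16 refl tge[OF i] tle[OF i] away[OF z(1) zr i] sq])
        (use h0 in simp)
  qed
qed

lemma coverable_good_scale:
  fixes \<mu> :: "'a::euclidean_space set \<Rightarrow> ennreal"
  assumes "\<And>A B. A \<subseteq> B \<Longrightarrow> \<mu> A \<le> \<mu> B" "2 \<le> L" "1 - 2 * \<alpha> \<le> 1 / 4 ^ L" "l \<le> DIM('a)"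
    and S: "diam_le S (1 / 2 ^ (k + L))" "\<And>x. x \<in> S \<Longrightarrow> good_scale l \<alpha> \<mu> \<epsilon> L x k"
  shows "coverable S (1 / 2 ^ (k + 2 * L)) (dir_const DIM('a) * (2 ^ L) ^ (DIM('a) - l))"
proof -
  have "\<forall>x\<in>S. \<exists>e :: nat \<Rightarrow> 'a. (\<forall>i\<in>{1..l}. norm (e i) = 1) \<and>
      (\<forall>i\<in>{1..l}. \<forall>j\<in>{1..l}. i \<noteq> j \<longrightarrow> e i \<bullet> e j = 0) \<and>
      (\<forall>z\<in>S. \<forall>i\<in>{1..l}. (z - x) \<bullet> e i \<le> 6 * (1 / 2 ^ (k + 2 * L)))"
  proof
    fix x assume x: "x \<in> S"
    obtain e :: "nat \<Rightarrow> 'a" where "\<And>i. i \<in> {1..l} \<Longrightarrow> norm (e i) = 1"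
      "\<And>i j. i \<in> {1..l} \<Longrightarrow> j \<in> {1..l} \<Longrightarrow> i \<noteq> j \<Longrightarrow> e i \<bullet> e j = 0"
      "\<And>z i. good_scale l \<alpha> \<mu> \<epsilon> L z k \<Longrightarrow> dist x z \<le> 1 / 2 ^ (k + L) \<Longrightarrow> i \<in> {1..l} \<Longrightarrow>
         (z - x) \<bullet> e i \<le> 6 * (1 / 2 ^ (k + 2 * L))"
      using good_scale_directions[OF assms(1-3) S(2)[OF x]] by metis
    then show "\<exists>e :: nat \<Rightarrow> 'a. (\<forall>i\<in>{1..l}. norm (e i) = 1) \<and>
      (\<forall>i\<in>{1..l}. \<forall>j\<in>{1..l}. i \<noteq> j \<longrightarrow> e i \<bullet> e j = 0) \<and>
      (\<forall>z\<in>S. \<forall>i\<in>{1..l}. (z - x) \<bullet> e i \<le> 6 * (1 / 2 ^ (k + 2 * L)))"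
      using S x unfolding diam_le_def by (intro exI[of _ e]) blast
  qed
  then obtain e :: "'a \<Rightarrow> nat \<Rightarrow> 'a" where e: "\<forall>x\<in>S. (\<forall>i\<in>{1..l}. norm (e x i) = 1) \<and>
      (\<forall>i\<in>{1..l}. \<forall>j\<in>{1..l}. i \<noteq> j \<longrightarrow> e x i \<bullet> e x j = 0) \<and>
      (\<forall>z\<in>S. \<forall>i\<in>{1..l}. (z - x) \<bullet> e x i \<le> 6 * (1 / 2 ^ (k + 2 * L)))"
    by (rule bchoice[THEN exE])
  \<comment> \<open>2^L is the ratio of the two diameters, hence the N of
    \<open>coverable_directions\<close>.\<close>
  have "real (2 ^ L) * (1 / 2 ^ (k + 2 * L)) = 1 / 2 ^ (k + L)"
    by (simp add: power_add mult_2)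
  then have "coverable S (1 / 2 ^ (k + 2 * L)) (dir_const DIM('a) * real (2 ^ L) ^ (DIM('a) - l))"
    by (intro coverable_directions[where e = e and l = l]) (use e S(1) assms(4) in auto)
  then show ?thesis by simp
qed

subsection \<open>Outer measures\<close>

lemma outer_measure_mono: "outer_measure_space UNIV \<mu> \<Longrightarrow> A \<subseteq> B \<Longrightarrow> \<mu> A \<le> \<mu> B"
  by (auto simp: outer_measure_space_def increasing_def)

lemma outer_measure_empty: "outer_measure_space UNIV \<mu> \<Longrightarrow> \<mu> {} = 0"
  by (auto simp: outer_measure_space_def positive_def)

text \<open>\<open>countably_subadditive\<close> speaks of disjoint families only;
  \<open>disjointed\<close> and monotonicity remove the restriction.\<close>

lemma outer_measure_UN:
  assumes "outer_measure_space UNIV \<mu>"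
  shows "\<mu> (\<Union>i. A i) \<le> (\<Sum>i::nat. \<mu> (A i))"
proof -
  have "\<mu> (\<Union>i. disjointed A i) \<le> (\<Sum>i. \<mu> (disjointed A i))"
    using assms disjoint_family_disjointed[of A]
    unfolding outer_measure_space_def countably_subadditive_def by blast
  also have "\<dots> \<le> (\<Sum>i. \<mu> (A i))"
    by (intro suminf_le outer_measure_mono[OF assms] disjointed_subset) auto
  finally show ?thesis by (simp add: UN_disjointed_eq)
qed

lemma outer_measure_null_UN:
  assumes "outer_measure_space UNIV \<mu>" "\<And>i::nat. \<mu> (A i) = 0"
  shows "\<mu> (\<Union>i. A i) = 0"
  using outer_measure_UN[OF assms(1), of A] assms(2) by simp

lemma outer_measure_Un:
  assumes "outer_measure_space UNIV \<mu>"
  shows "\<mu> (A \<union> B) \<le> \<mu> A + \<mu> B"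
proof -
  let ?C = "\<lambda>i::nat. if i = 0 then A else if i = 1 then B else {}"
  have "A \<union> B = (\<Union>i. ?C i)" by (auto split: if_splits)
  then have "\<mu> (A \<union> B) \<le> (\<Sum>i. \<mu> (?C i))" using outer_measure_UN[OF assms, of ?C] by simp
  also have "\<dots> = (\<Sum>i\<in>{0,1}. \<mu> (?C i))"
    by (rule suminf_finite) (auto simp: outer_measure_empty[OF assms])
  finally show ?thesis by simp
qed

lemma outer_measure_finite_UN:
  assumes "outer_measure_space UNIV \<mu>" "finite I"
  shows "\<mu> (\<Union>i\<in>I. A i) \<le> (\<Sum>i\<in>I. \<mu> (A i))"
  using assms(2)
proof induction
  case (insert i I)
  have "\<mu> (\<Union>j\<in>insert i I. A j) \<le> \<mu> (A i) + \<mu> (\<Union>j\<in>I. A j)"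
    using outer_measure_Un[OF assms(1)] by simp
  then show ?case
    using insert by (simp add: add_left_mono order_trans)
qed (simp add: outer_measure_empty[OF assms(1)])

text \<open>Compactness of the closed ball; the open balls inside the given closed ones form the
  cover.\<close>

lemma outer_measure_bounded_finite:
  fixes \<mu> :: "'a::euclidean_space set \<Rightarrow> ennreal"
  assumes "outer_measure_space UNIV \<mu>" "locally_finite \<mu>"
  shows "\<mu> (cball x R) < \<infinity>"
proof -
  obtain r where r: "\<And>x::'a. r x > 0 \<and> \<mu> (cball x (r x)) < \<infinity>"
    using assms(2) unfolding locally_finite_def by metis
  have "cball x R \<subseteq> (\<Union>y\<in>cball x R. ball y (r y))" using r by force
  then obtain F where F: "F \<subseteq> cball x R" "finite F" "cball x R \<subseteq> (\<Union>y\<in>F. ball y (r y))"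
    using compactE_image[OF compact_cball, of "cball x R" "\<lambda>y. ball y (r y)"] by (metis open_ball)
  have "\<mu> (cball x R) \<le> \<mu> (\<Union>y\<in>F. cball y (r y))"
    by (rule outer_measure_mono[OF assms(1)]) (use F(3) ball_subset_cball in blast)
  also have "\<dots> \<le> (\<Sum>y\<in>F. \<mu> (cball y (r y)))"
    by (rule outer_measure_finite_UN[OF assms(1) F(2)])
  also have "\<dots> < \<infinity>" using F(2) r by (simp add: ennreal_sum_less_top)
  finally show ?thesis .
qed

text \<open>The part of A in one piece lies in a ball of radius \<rho> centred at one of its own
  points, whose mass is known to be small.\<close>

lemma outer_measure_coverable:
  assumes \<mu>: "outer_measure_space UNIV \<mu>" and "coverable A \<rho> M" "0 \<le> t"
    and t: "\<And>x. x \<in> A \<Longrightarrow> \<mu> (cball x \<rho>) \<le> ennreal t"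
  shows "\<mu> A \<le> ennreal (M * t)"
proof -
  obtain F where F: "finite F" "real (card F) \<le> M" "A \<subseteq> \<Union>F" "\<forall>U\<in>F. diam_le U \<rho>"
    using assms(2) unfolding coverable_def by blast
  have "\<mu> (U \<inter> A) \<le> ennreal t" if U: "U \<in> F" for U
  proof (cases "U \<inter> A = {}")
    case True
    then show ?thesis by (simp add: outer_measure_empty[OF \<mu>])
  next
    case False
    then obtain x where x: "x \<in> U" "x \<in> A" by blast
    then have "U \<inter> A \<subseteq> cball x \<rho>" using F(4) U by (auto simp: diam_le_def)
    then have "\<mu> (U \<inter> A) \<le> \<mu> (cball x \<rho>)" by (rule outer_measure_mono[OF \<mu>])
    then show ?thesis using t[OF x(2)] by (rule order_trans)
  qed
  then have "(\<Sum>U\<in>F. \<mu> (U \<inter> A)) \<le> of_nat (card F) * ennreal t"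
    by (intro sum_bounded_above)
  moreover have "\<mu> A \<le> \<mu> (\<Union>U\<in>F. U \<inter> A)"
    by (rule outer_measure_mono[OF \<mu>]) (use F(3) in blast)
  moreover have "\<dots> \<le> (\<Sum>U\<in>F. \<mu> (U \<inter> A))"
    by (rule outer_measure_finite_UN[OF \<mu> F(1)])
  moreover have "of_nat (card F) * ennreal t = ennreal (real (card F) * t)"
    using assms(3) by (simp add: ennreal_mult ennreal_of_nat_eq_real_of_nat)
  moreover have "\<dots> \<le> ennreal (M * t)"
    using F(2) assms(3) by (intro ennreal_leI mult_right_mono)
  ultimately show ?thesis by simp
qed

lemma outer_measure_null_subset:
  assumes "outer_measure_space UNIV \<mu>" "\<mu> A = 0" "B \<subseteq> A"
  shows "\<mu> B = 0"
  using outer_measure_mono[OF assms(1,3)] assms(2) by simp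

lemma outer_measure_null_subset_Un:
  assumes "outer_measure_space UNIV \<mu>" "\<mu> A = 0" "\<mu> B = 0" "C \<subseteq> A \<union> B"
  shows "\<mu> C = 0"
proof -
  have "\<mu> C \<le> \<mu> (A \<union> B)" by (rule outer_measure_mono[OF assms(1,4)])
  also have "\<dots> \<le> \<mu> A + \<mu> B" by (rule outer_measure_Un[OF assms(1)])
  finally show ?thesis by (simp add: assms(2,3))
qed

lemma null_UN_cball:
  fixes \<mu> :: "'a::real_normed_vector set \<Rightarrow> ennreal"
  assumes "outer_measure_space UNIV \<mu>" "\<And>R::nat. \<mu> (A \<inter> cball 0 (real R)) = 0"
  shows "\<mu> A = 0"
proof -
  have "A \<subseteq> (\<Union>R. A \<inter> cball 0 (real R))"
    using real_arch_simple by auto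
  then have "\<mu> A \<le> \<mu> (\<Union>R. A \<inter> cball 0 (real R))" by (rule outer_measure_mono[OF assms(1)])
  also have "\<dots> = 0" by (rule outer_measure_null_UN[OF assms])
  finally show ?thesis by simp
qed

text \<open>The limsup set lies in the union of every tail of the sequence, whose measure is at most
  the tail of a geometric series.\<close>

lemma borel_cantelli_geometric:
  assumes \<mu>: "outer_measure_space UNIV \<mu>" and b: "0 \<le> b" "b < 1" "0 \<le> K"
    and A: "\<And>n. \<mu> (A n) \<le> ennreal (K * b ^ n)"
  shows "\<mu> {x. \<exists>\<^sub>F n in sequentially. x \<in> A n} = 0"
proof -
  let ?E = "{x. \<exists>\<^sub>F n in sequentially. x \<in> A n}"
  have le: "\<mu> ?E \<le> ennreal (K * b ^ m / (1 - b))" for m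
  proof -
    have "?E \<subseteq> (\<Union>n. A (n + m))"
    proof
      fix x assume "x \<in> ?E"
      then obtain n where "n \<ge> m" "x \<in> A n" by (auto simp: frequently_sequentially)
      then have "x \<in> A ((n - m) + m)" by simp
      then show "x \<in> (\<Union>n. A (n + m))" by blast
    qed
    then have "\<mu> ?E \<le> \<mu> (\<Union>n. A (n + m))" by (rule outer_measure_mono[OF \<mu>])
    also have "\<dots> \<le> (\<Sum>n. \<mu> (A (n + m)))" by (rule outer_measure_UN[OF \<mu>])
    also have "\<dots> \<le> (\<Sum>n. ennreal (K * b ^ m * b ^ n))"
    proof (intro suminf_le)
      show "\<mu> (A (n + m)) \<le> ennreal (K * b ^ m * b ^ n)" for n
        using A[of "n + m"] by (simp add: power_add mult_ac)
    qed auto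
    also have "\<dots> = ennreal (K * b ^ m * (1 / (1 - b)))"
    proof (rule suminf_ennreal_eq)
      show "(\<lambda>n. K * b ^ m * b ^ n) sums (K * b ^ m * (1 / (1 - b)))"
        by (intro sums_mult geometric_sums) (use b in auto)
    qed (use b in auto)
    finally show ?thesis by simp
  qed
  have "(\<lambda>m. ennreal (K * b ^ m / (1 - b))) \<longlonglongrightarrow> ennreal (K * 0 / (1 - b))"
    by (intro tendsto_intros LIMSEQ_power_zero) (use b in auto)
  then have "\<mu> ?E \<le> ennreal (K * 0 / (1 - b))"
    by (rule LIMSEQ_le_const) (use le in auto)
  then show ?thesis by simp
qed

subsection \<open>Counting good scales\<close>

text \<open>Each unit drop of u occurs in at most w windows of length w. Induction on w splits off
  the last unit step of every window; these steps telescope. Monotonicity is asked only up to T + w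
  because the application takes logarithms of masses known to be positive only so far.\<close>

lemma sum_drops_le:
  fixes u :: "nat \<Rightarrow> real"
  assumes "\<And>i j. i \<le> j \<Longrightarrow> j \<le> T + w \<Longrightarrow> u j \<le> u i"
  shows "(\<Sum>k<T. u k - u (k + w)) \<le> w * (u 0 - u (T + w))"
  using assms
proof (induction w)
  case (Suc w)
  have "(\<Sum>k<T. u k - u (k + Suc w)) =
      (\<Sum>k<T. u k - u (k + w)) + (\<Sum>k<T. u (k + w) - u (Suc k + w))"
    by (simp flip: sum.distrib)
  also have "(\<Sum>k<T. u (k + w) - u (Suc k + w)) = u w - u (T + w)"
    using sum_lessThan_telescope'[of "\<lambda>k. u (k + w)" T] by simp
  also have "u w - u (T + w) \<le> u 0 - u (T + Suc w)"
    using Suc.prems[of 0 w] Suc.prems[of "T + w" "T + Suc w"] by simp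
  also have "(\<Sum>k<T. u k - u (k + w)) \<le> w * (u 0 - u (T + w))"
    by (rule Suc.IH) (use Suc.prems in auto)
  also have "w * (u 0 - u (T + w)) \<le> w * (u 0 - u (T + Suc w))"
    using Suc.prems[of "T + w" "T + Suc w"] by (intro mult_left_mono) auto
  finally show ?case by (simp add: algebra_simps)
qed simp

text \<open>By \<open>sum_drops_le\<close> the drops over windows of length 2 L + 1 sum to at most 2
  L + 1 times the total drop, so few windows can carry q. The summand 1 pays for the scales close to
  n.\<close>

lemma card_drops_le:
  fixes u :: "nat \<Rightarrow> real"
  assumes mono: "\<And>i j. i \<le> j \<Longrightarrow> j \<le> n \<Longrightarrow> u j \<le> u i" and "0 < q"
  shows "real (card {k \<in> {1..n}. k + 2 * L \<le> n \<longrightarrow> q \<le> u (k - 1) - u (k + 2 * L)})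
     \<le> (2 * real L + 1) * (1 + (u 0 - u n) / q)"
proof (cases "n \<le> 2 * L + 1")
  case True
  have "card {k \<in> {1..n}. k + 2 * L \<le> n \<longrightarrow> q \<le> u (k - 1) - u (k + 2 * L)} \<le> card {1..n}"
    by (intro card_mono) auto
  then have "real (card {k \<in> {1..n}. k + 2 * L \<le> n \<longrightarrow> q \<le> u (k - 1) - u (k + 2 * L)})
      \<le> (2 * real L + 1) * 1"
    using True by simp
  also have "\<dots> \<le> (2 * real L + 1) * (1 + (u 0 - u n) / q)"
    using mono[of 0 n] assms(2) by (intro mult_left_mono) auto
  finally show ?thesis .
next
  case False
  \<comment> \<open>Now n > w, so the natural subtraction is exact. The last w scales are all
    counted as bad.\<close>
  define w T where "w = 2 * L + 1" and "T = n - w"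
  have n: "n = T + w" using False by (simp add: w_def T_def)
  define D where "D = {k. k < T \<and> q \<le> u k - u (k + w)}"
  have "{k \<in> {1..n}. k + 2 * L \<le> n \<longrightarrow> q \<le> u (k - 1) - u (k + 2 * L)} \<subseteq> Suc ` D \<union> {T<..n}"
  proof
    fix k assume k: "k \<in> {k \<in> {1..n}. k + 2 * L \<le> n \<longrightarrow> q \<le> u (k - 1) - u (k + 2 * L)}"
    show "k \<in> Suc ` D \<union> {T<..n}"
    proof (cases "k \<le> T")
      case True
      then have "k - 1 \<in> D" "k = Suc (k - 1)" using k n by (auto simp: D_def w_def)
      then show ?thesis by blast
    qed (use k in auto)
  qed
  then have "card {k \<in> {1..n}. k + 2 * L \<le> n \<longrightarrow> q \<le> u (k - 1) - u (k + 2 * L)}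
      \<le> card (Suc ` D \<union> {T<..n})"
    by (intro card_mono) (auto simp: D_def)
  also have "\<dots> \<le> card D + w"
    using card_Un_le[of "Suc ` D" "{T<..n}"] card_image_le[of D Suc] n by (simp add: D_def)
  finally have 1: "real (card {k \<in> {1..n}. k + 2 * L \<le> n \<longrightarrow> q \<le> u (k - 1) - u (k + 2 * L)})
      \<le> real (card D) + w"
    by linarith
  have "real (card D) * q \<le> (\<Sum>k\<in>D. u k - u (k + w))"
    using sum_bounded_below[of D q "\<lambda>k. u k - u (k + w)"] by (auto simp: D_def)
  also have "\<dots> \<le> (\<Sum>k<T. u k - u (k + w))"
    by (intro sum_mono2) (use mono n in \<open>auto simp: D_def\<close>)
  also have "\<dots> \<le> w * (u 0 - u n)"
    unfolding n by (rule sum_drops_le) (use mono n in auto)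
  finally have "real (card D) \<le> w * (u 0 - u n) / q"
    using assms(2) by (simp add: pos_le_divide_eq)
  with 1 have "real (card {k \<in> {1..n}. k + 2 * L \<le> n \<longrightarrow> q \<le> u (k - 1) - u (k + 2 * L)})
      \<le> real w + real w * (u 0 - u n) / q"
    by linarith
  also have "\<dots> = (2 * real L + 1) * (1 + (u 0 - u n) / q)"
    by (simp add: w_def distrib_left add.commute)
  finally show ?thesis .
qed

text \<open>A porous scale that is not good loses at least a factor \<open>2 ^ q\<close> of mass
  between the radii \<open>1 / 2 ^ (k - 1)\<close> and \<open>1 / 2 ^ (k + 2 * L)\<close>. In
  logarithms this is a drop of q, while the total drop from radius 1 to \<open>1 / 2 ^ n\<close> is
  at most M + s.\<close>

lemma card_good_scales_ge:
  fixes \<mu> :: "'a::euclidean_space set \<Rightarrow> ennreal"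
  assumes \<mu>: "outer_measure_space UNIV \<mu>" and "0 < q"
    and porous: "mean_porous_upto l \<alpha> p \<mu> x (1 / 2 ^ q) n"
    and big: "ennreal (2 powr - s) < \<mu> (cball x (1 / 2 ^ n))"
    and M: "\<mu> (cball x 1) \<le> ennreal (2 powr M)"
  shows "p * n - (2 * real L + 1) * (1 + (M + s) / q)
    \<le> card {k \<in> {1..n}. good_scale l \<alpha> \<mu> (1 / 2 ^ q) L x k}"
proof -
  define m where "m k = \<mu> (cball x (1 / 2 ^ k))" for k :: nat
  define u where "u k = log 2 (enn2real (m k))" for k
  have mono: "m j \<le> m i" if "i \<le> j" for i j
    unfolding m_def using that
    by (intro outer_measure_mono[OF \<mu>] subset_cball) (simp add: divide_simps)
  have fin: "m k < \<infinity>" for k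
    using mono[of 0 k] M by (simp add: m_def top.not_eq_extremum le_less_trans)
  \<comment> \<open>\<open>big\<close> makes the masses positive up to index n; there the logarithms
    are genuine.\<close>
  have pos: "0 < enn2real (m k)" if "k \<le> n" for k
  proof -
    have "0 < m n" using big by (auto simp: m_def intro: le_less_trans[rotated])
    then have "0 < m k" using mono[OF that] by (rule less_le_trans)
    then show ?thesis using fin[of k] by (simp add: enn2real_positive_iff)
  qed
  have umono: "u j \<le> u i" if "i \<le> j" "j \<le> n" for i j
    unfolding u_def using pos[of j] pos[of i] that mono[of i j] fin[of i]
    by (simp add: enn2real_mono)
  have u0: "u 0 \<le> M"
  proof -
    have "enn2real (m 0) \<le> 2 powr M" using M by (intro enn2real_leI) (auto simp: m_def)
    then show ?thesis unfolding u_def using pos[of 0] by (simp add: log_le_iff)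
  qed
  have un: "- s \<le> u n"
  proof -
    have "2 powr - s \<le> enn2real (m n)"
      using big fin[of n] by (cases "m n") (auto simp: m_def ennreal_less_iff)
    then show ?thesis unfolding u_def using pos[of n] by (simp add: le_log_iff)
  qed
  let ?P = "{k \<in> {1..n}. ereal \<alpha> < por l \<mu> x (1 / 2 ^ k) (1 / 2 ^ q)}"
  let ?B = "{k \<in> {1..n}. k + 2 * L \<le> n \<longrightarrow> real q \<le> u (k - 1) - u (k + 2 * L)}"
  let ?G = "{k \<in> {1..n}. good_scale l \<alpha> \<mu> (1 / 2 ^ q) L x k}"
  have "k \<in> ?G" if k: "k \<in> ?P" "k \<notin> ?B" for k
  proof -
    have kn: "1 \<le> k" "k + 2 * L \<le> n" and lt: "u (k - 1) - u (k + 2 * L) < q" using k by auto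
    have "log 2 (enn2real (m (k - 1)) / 2 ^ q) < log 2 (enn2real (m (k + 2 * L)))"
      using lt pos[of "k - 1"] kn by (simp add: u_def log_divide_pos)
    then have "enn2real (m (k - 1)) / 2 ^ q < enn2real (m (k + 2 * L))"
      using pos[of "k - 1"] pos[of "k + 2 * L"] kn by simp
    then have "ennreal (1 / 2 ^ q * enn2real (m (k - 1))) < ennreal (enn2real (m (k + 2 * L)))"
      using pos[of "k + 2 * L"] kn by (intro ennreal_lessI) auto
    also have "ennreal (enn2real (m (k + 2 * L))) = m (k + 2 * L)"
      using fin[of "k + 2 * L"] by simp
    also have "ennreal (1 / 2 ^ q * enn2real (m (k - 1))) = ennreal (1 / 2 ^ q) * m (k - 1)"
      using fin[of "k - 1"] by (subst ennreal_mult) auto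
    finally have "ennreal (1 / 2 ^ q) * m (k - 1) < m (k + 2 * L)" .
    moreover have "2 / 2 ^ k = (1 / 2 ^ (k - 1) :: real)"
      using kn by (cases k) auto
    ultimately show ?thesis using k by (auto simp: good_scale_def m_def)
  qed
  then have "card ?P \<le> card (?G \<union> ?B)" by (intro card_mono) auto
  also have "\<dots> \<le> card ?G + card ?B" by (rule card_Un_le)
  finally have "real (card ?P) \<le> card ?G + real (card ?B)" by linarith
  moreover have "p * n \<le> card ?P" using porous by (simp add: mean_porous_upto_def)
  moreover have "real (card ?B) \<le> (2 * real L + 1) * (1 + (u 0 - u n) / q)"
    using umono assms(2) by (intro card_drops_le) auto
  moreover have "\<dots> \<le> (2 * real L + 1) * (1 + (M + s) / q)"
    using u0 un assms(2) by (intro mult_left_mono add_left_mono divide_right_mono) auto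
  ultimately show ?thesis by linarith
qed

text \<open>The covering at a good scale k passes from diameter 2^-(k+L) to 2^-(k+2L), so
  consecutive steps must be L scales apart. Some residue class modulo L has at least the average
  share.\<close>

lemma exists_large_residue:
  fixes L n :: nat and \<Gamma> :: real
  assumes "0 < L" "\<Gamma> \<le> real (card {k \<in> {1..n}. P k})"
  obtains a where "a < L" "\<Gamma> \<le> L * real (card {j. j < n div L + 1 \<and> P (a + 1 + j * L)})"
proof -
  define J where "J = n div L + 1"
  define Q where "Q a = {j. j < J \<and> P (a + 1 + j * L)}" for a
  have "{k \<in> {1..n}. P k} \<subseteq> (\<Union>a<L. (\<lambda>j. a + 1 + j * L) ` Q a)"
  proof
    fix k assume k: "k \<in> {k \<in> {1..n}. P k}"
    define a j where "a = (k - 1) mod L" and "j = (k - 1) div L"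
    have eq: "k = a + 1 + j * L" using k by (simp add: a_def j_def)
    have "j < J" unfolding j_def J_def using k by (auto intro!: le_imp_less_Suc div_le_mono)
    moreover have "a < L" using assms(1) by (simp add: a_def)
    ultimately show "k \<in> (\<Union>a<L. (\<lambda>j. a + 1 + j * L) ` Q a)"
      using eq k by (auto simp: Q_def)
  qed
  then have "card {k \<in> {1..n}. P k} \<le> card (\<Union>a<L. (\<lambda>j. a + 1 + j * L) ` Q a)"
    by (intro card_mono) (auto simp: Q_def)
  also have "\<dots> \<le> (\<Sum>a<L. card ((\<lambda>j. a + 1 + j * L) ` Q a))"
    by (rule card_UN_le) simp
  also have "\<dots> \<le> (\<Sum>a<L. card (Q a))"
    by (intro sum_mono card_image_le) (simp add: Q_def)
  finally have \<Gamma>: "\<Gamma> \<le> (\<Sum>a<L. real (card (Q a)))"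
    using assms(2) by (simp flip: of_nat_sum)
  have "\<exists>a<L. \<Gamma> / L \<le> card (Q a)"
  proof (rule ccontr)
    assume "\<not> ?thesis"
    then have "(\<Sum>a<L. real (card (Q a))) < (\<Sum>a<L. \<Gamma> / L)"
      using assms(1) by (intro sum_strict_mono) (auto simp: not_le)
    then show False using \<Gamma> assms(1) by simp
  qed
  then obtain a where "a < L" "\<Gamma> / L \<le> card (Q a)" by blast
  then show thesis
    using assms(1) that[of a] by (simp add: Q_def J_def pos_divide_le_eq mult.commute)
qed

subsection \<open>Covering mean porous sets\<close>

text \<open>Lets one constant pay for both kinds of subdivision: a plain step of ratio
  \<open>2 ^ L\<close> needs at most \<open>(3 * d) ^ d * 2 ^ (L * d)\<close> pieces.\<close>

lemma dir_const_ge: "1 \<le> d \<Longrightarrow> (3 * real d) ^ d \<le> dir_const d"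
proof -
  assume d: "1 \<le> d"
  have "d \<le> 28 * d\<^sup>2 + 1" using le_square[of d] unfolding power2_eq_square by linarith
  then have "real d ^ d \<le> real ((28 * d\<^sup>2 + 1) ^ d)"
    by (simp only: of_nat_power of_nat_le_iff power_mono)
  moreover have "(1::real) \<le> real ((8 * d\<^sup>2 + 1) ^ (d * d))"
    unfolding real_of_nat_ge_one_iff by (rule one_le_power) simp
  ultimately have "1 * 3 ^ d * real d ^ d \<le> dir_const d"
    unfolding dir_const_def by (intro mult_mono) auto
  then show ?thesis by (simp add: power_mult_distrib)
qed

lemma dir_const_ge_1: "1 \<le> d \<Longrightarrow> 1 \<le> dir_const d"
  using dir_const_ge[of d] one_le_power[of "3 * real d" d] by simp

text \<open>\<open>coverable_tree\<close> is run along each residue class of scales. A plain step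
  costs P, a good one saves the factor \<kappa> = 2^-(L l), and some class has at least \<Gamma> / L
  good steps, so the total saving is at least 2^(l \<Gamma>). The factor L sums over the
  classes.\<close>

lemma coverable_good_scales:
  fixes \<mu> :: "'a::euclidean_space set \<Rightarrow> ennreal" and \<Gamma> :: real
  assumes \<mu>: "outer_measure_space UNIV \<mu>"
    and L: "2 \<le> L" "1 - 2 * \<alpha> \<le> 1 / 4 ^ L" "l \<le> DIM('a)"
    and K: "coverable K (1 / 2 ^ (2 * L)) M" "0 \<le> M"
  shows "coverable {x \<in> K. \<Gamma> \<le> card {k \<in> {1..n}. good_scale l \<alpha> \<mu> \<epsilon> L x k}} (1 / 2 ^ n)
    (L * (M * (2 * (dir_const DIM('a) * 2 ^ (L * DIM('a)))) ^ (n div L + 1) * 2 powr (- (l * \<Gamma>))))"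
proof -
  let ?d = "DIM('a)" and ?J = "n div L + 1"
  define D P \<kappa> where "D = dir_const ?d" and "P = D * 2 ^ (L * ?d)" and "\<kappa> = 1 / (2::real) ^ (L * l)"
  \<comment> \<open>For negative \<Gamma>, possible for small n, \<open>nat\<close> gives g = 0 and
    \<Gamma> \<le> L * g still holds.\<close>
  define g where "g = nat \<lceil>\<Gamma> / L\<rceil>"
  have d1: "1 \<le> ?d" using DIM_positive[where 'a='a] by simp
  have D1: "1 \<le> D" unfolding D_def by (rule dir_const_ge_1[OF d1])
  then have P0: "0 \<le> P" by (simp add: P_def)
  have \<kappa>0: "0 \<le> \<kappa>" by (simp add: \<kappa>_def)
  let ?E = "\<lambda>a. {x \<in> K. g \<le> card {j. j < ?J \<and> good_scale l \<alpha> \<mu> \<epsilon> L x (a + 1 + j * L)}}"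
  have sub: "{x \<in> K. \<Gamma> \<le> card {k \<in> {1..n}. good_scale l \<alpha> \<mu> \<epsilon> L x k}} \<subseteq> (\<Union>a<L. ?E a)"
  proof
    fix x assume x: "x \<in> {x \<in> K. \<Gamma> \<le> card {k \<in> {1..n}. good_scale l \<alpha> \<mu> \<epsilon> L x k}}"
    obtain a where a: "a < L"
      "\<Gamma> \<le> L * real (card {j. j < ?J \<and> good_scale l \<alpha> \<mu> \<epsilon> L x (a + 1 + j * L)})"
      using exists_large_residue[of L \<Gamma> n "good_scale l \<alpha> \<mu> \<epsilon> L x"] L(1) x by auto
    then have "\<Gamma> / L \<le> real (card {j. j < ?J \<and> good_scale l \<alpha> \<mu> \<epsilon> L x (a + 1 + j * L)})"
      using L(1) by (simp add: pos_divide_le_eq mult.commute)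
    then have "g \<le> card {j. j < ?J \<and> good_scale l \<alpha> \<mu> \<epsilon> L x (a + 1 + j * L)}"
      unfolding g_def by (simp add: nat_le_iff ceiling_le_iff)
    then show "x \<in> (\<Union>a<L. ?E a)" using a(1) x by auto
  qed
  have piece: "coverable (?E a) (1 / 2 ^ n) (M * (2 * P) ^ ?J * \<kappa> ^ g)" if a: "a < L" for a
  proof -
    \<comment> \<open>Step j treats scale k = a + 1 + j L, and \<rho> j = 2^-(k+L) is the diameter
      at which \<open>coverable_good_scale\<close> applies.\<close>
    define \<rho> where "\<rho> j = (1::real) / 2 ^ (a + 1 + j * L + L)" for j
    have \<rho>Suc: "\<rho> (Suc j) = 1 / 2 ^ (a + 1 + j * L + 2 * L)" for j
    proof -
      have "a + 1 + Suc j * L + L = a + 1 + j * L + 2 * L" by simp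
      then show ?thesis by (simp only: \<rho>_def)
    qed
    have \<rho>2: "\<rho> j = 2 ^ L * \<rho> (Suc j)" for j
      by (simp add: \<rho>_def power_add)
    have "coverable (?E a) (\<rho> ?J) (M * (2 * P) ^ ?J * \<kappa> ^ g)"
    proof (rule coverable_tree[OF P0 \<kappa>0])
      show "coverable T (\<rho> (Suc j)) P" if "diam_le T (\<rho> j)" for j and T :: "'a set"
      proof (rule coverable_mono)
        show "coverable T (\<rho> (Suc j)) ((2 * real (?d * 2 ^ L) + 1) ^ ?d)"
          using that by (rule coverable_plain) (auto simp: \<rho>2[of j], simp add: \<rho>_def)
        have "1 \<le> real (?d * 2 ^ L)"
          using d1 unfolding real_of_nat_ge_one_iff by simp
        then have "(2 * real (?d * 2 ^ L) + 1) ^ ?d \<le> (3 * real (?d * 2 ^ L)) ^ ?d"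
          by (intro power_mono) auto
        also have "\<dots> = (3 * real ?d) ^ ?d * 2 ^ (L * ?d)"
          by (simp add: power_mult_distrib power_mult)
        also have "\<dots> \<le> P"
          unfolding P_def D_def by (intro mult_right_mono dir_const_ge d1) auto
        finally show "(2 * real (?d * 2 ^ L) + 1) ^ ?d \<le> P" .
      qed auto
    next
      fix j and T :: "'a set"
      assume T: "diam_le T (\<rho> j)" "\<And>x. x \<in> T \<Longrightarrow> good_scale l \<alpha> \<mu> \<epsilon> L x (a + 1 + j * L)"
      have "coverable T (\<rho> (Suc j)) (D * (2 ^ L) ^ (?d - l))"
        unfolding \<rho>Suc D_def
        by (rule coverable_good_scale[OF outer_measure_mono[OF \<mu>] L])
          (use T in \<open>auto simp: \<rho>_def\<close>)
      moreover have "(2::real) ^ (L * ?d) = 2 ^ (L * (?d - l)) * 2 ^ (L * l)"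
        using L(3) by (simp flip: power_add distrib_left)
      then have "D * (2 ^ L) ^ (?d - l) = P * \<kappa>"
        by (simp add: P_def \<kappa>_def power_mult)
      ultimately show "coverable T (\<rho> (Suc j)) (P * \<kappa>)" by simp
    next
      \<comment> \<open>a < L gives a + 1 + L \<le> 2 L, so one starting cover serves all
        classes.\<close>
      show "coverable K (\<rho> 0) M"
        using K(1) by (rule coverable_mono)
          (use a in \<open>auto simp: \<rho>_def intro!: divide_left_mono power_increasing simp flip: power_Suc\<close>)
    qed (rule K(2))
    moreover have "\<rho> ?J \<le> 1 / 2 ^ n"
    proof -
      have "n \<le> L + n div L * L"
        using mod_less_divisor[of L n] div_mult_mod_eq[of n L] L(1) by linarith
      then have "n \<le> a + 1 + ?J * L + L" by simp
      then show ?thesis unfolding \<rho>_def by (intro divide_left_mono power_increasing) auto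
    qed
    ultimately show ?thesis by (rule coverable_mono[OF _ order_refl _ order_refl])
  qed
  have "coverable (\<Union>a<L. ?E a) (1 / 2 ^ n) (card {..<L} * (M * (2 * P) ^ ?J * \<kappa> ^ g))"
    by (intro coverable_UN piece) auto
  then show ?thesis
  proof (rule coverable_mono[OF _ sub order_refl])
    have "\<Gamma> / L \<le> real g" unfolding g_def by linarith
    then have "\<Gamma> \<le> L * g" using L(1) by (simp add: pos_divide_le_eq mult.commute)
    then have "l * \<Gamma> \<le> l * (L * real g)" by (intro mult_left_mono) auto
    have "\<kappa> ^ g = 2 powr (- (l * (L * real g)))"
    proof -
      have "\<kappa> ^ g = 1 / 2 ^ (L * l * g)" by (simp add: \<kappa>_def power_divide power_mult)
      also have "(2::real) ^ (L * l * g) = 2 powr (l * (L * real g))"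
        using powr_realpow[of 2 "L * l * g"] by (simp add: mult_ac)
      finally show ?thesis by (simp add: powr_minus_divide)
    qed
    also have "\<dots> \<le> 2 powr (- (l * \<Gamma>))"
      using \<open>l * \<Gamma> \<le> l * (L * real g)\<close> by (intro powr_mono) auto
    finally have "\<kappa> ^ g \<le> 2 powr (- (l * \<Gamma>))" .
    then show "card {..<L} * (M * (2 * P) ^ ?J * \<kappa> ^ g)
      \<le> L * (M * (2 * (dir_const DIM('a) * 2 ^ (L * DIM('a)))) ^ (n div L + 1) * 2 powr (- (l * \<Gamma>)))"
      unfolding P_def[symmetric] D_def[symmetric] card_lessThan
      using P0 K(2) by (intro mult_left_mono) auto
  qed
qed

text \<open>O(2^(n d)) pieces of mass at most 2^-(s n) give a summable series if s > d. Used with s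
  = d + 1 as an a priori lower bound on masses, and on its own when \<alpha> is far from
  1/2.\<close>

lemma null_frequently_small_balls:
  fixes \<mu> :: "'a::euclidean_space set \<Rightarrow> ennreal" and s :: real
  assumes \<mu>: "outer_measure_space UNIV \<mu>" and s: "DIM('a) < s"
  shows "\<mu> {x. \<exists>\<^sub>F n in sequentially. \<mu> (cball x (1 / 2 ^ n)) \<le> ennreal (2 powr (- (s * n)))} = 0"
proof (rule null_UN_cball[OF \<mu>])
  fix R :: nat
  obtain M where M: "0 \<le> M"
    "\<And>n. coverable (cball (0::'a) R) (1 / 2 ^ n) (M * 2 ^ (n * DIM('a)))"
    using coverable_cball by metis
  define A where "A n = {x \<in> cball 0 R. \<mu> (cball x (1 / 2 ^ n)) \<le> ennreal (2 powr (- (s * n)))}" for n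
  have "\<mu> {x. \<exists>\<^sub>F n in sequentially. x \<in> A n} = 0"
  proof (rule borel_cantelli_geometric[OF \<mu>])
    fix n
    have "coverable (A n) (1 / 2 ^ n) (M * 2 ^ (n * DIM('a)))"
      by (rule coverable_mono[OF M(2)]) (auto simp: A_def)
    then have "\<mu> (A n) \<le> ennreal (M * 2 ^ (n * DIM('a)) * 2 powr (- (s * n)))"
      by (rule outer_measure_coverable[OF \<mu>]) (auto simp: A_def)
    also have "M * 2 ^ (n * DIM('a)) * 2 powr (- (s * n)) = M * (2 powr (DIM('a) - s)) ^ n"
    proof -
      have "(2::real) ^ (n * DIM('a)) = 2 powr real (n * DIM('a))"
        by (rule powr_realpow[symmetric]) simp
      moreover have "2 powr real (n * DIM('a)) * 2 powr (- (s * n)) = 2 powr ((DIM('a) - s) * n)"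
      proof -
        have "real (n * DIM('a)) + - (s * n) = (DIM('a) - s) * n" by (simp add: algebra_simps)
        then show ?thesis by (simp only: powr_add[symmetric])
      qed
      moreover have "(2 powr (DIM('a) - s)) ^ n = 2 powr ((DIM('a) - s) * n)"
        by (simp add: powr_power mult.commute)
      ultimately show ?thesis by (simp add: mult.assoc)
    qed
    finally show "\<mu> (A n) \<le> ennreal (M * (2 powr (DIM('a) - s)) ^ n)" .
  next
    show "2 powr (DIM('a) - s) < 1" using s by (simp add: powr_less_one)
  qed (use M in auto)
  moreover have "{x. \<exists>\<^sub>F n in sequentially. \<mu> (cball x (1 / 2 ^ n)) \<le> ennreal (2 powr (- (s * n)))}
      \<inter> cball 0 R \<subseteq> {x. \<exists>\<^sub>F n in sequentially. x \<in> A n}"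
    by (auto simp: A_def)
  ultimately show "\<mu> ({x. \<exists>\<^sub>F n in sequentially. \<mu> (cball x (1 / 2 ^ n)) \<le> ennreal (2 powr (- (s * n)))}
      \<inter> cball 0 R) = 0"
    by (rule outer_measure_null_subset[OF \<mu>])
qed

text \<open>Borel-Cantelli with the tree covering. The constants 2 and D are paid once per L scales,
  which gives the term log (2 D) / L. The set asks for all \<epsilon> because the one chosen, 2^-q,
  depends on how far s exceeds the threshold.\<close>

lemma null_frequently_porous:
  fixes \<mu> :: "'a::euclidean_space set \<Rightarrow> ennreal" and s p :: real
  assumes \<mu>: "outer_measure_space UNIV \<mu>" "locally_finite \<mu>"
    and L: "2 \<le> L" "1 - 2 * \<alpha> \<le> 1 / 4 ^ L" "l \<le> DIM('a)"
    and s: "DIM('a) - p * l + log 2 (2 * dir_const DIM('a)) / L < s"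
  shows "\<mu> {x. \<forall>\<epsilon>>0. \<exists>\<^sub>F n in sequentially.
    mean_porous_upto l \<alpha> p \<mu> x \<epsilon> n \<and> \<mu> (cball x (1 / 2 ^ n)) \<le> ennreal (2 powr (- (s * n)))} = 0"
    (is "\<mu> ?F = 0")
proof (rule null_UN_cball[OF \<mu>(1)])
  fix R :: nat
  let ?d = "DIM('a)"
  let ?K = "cball (0::'a) R"
  define D where "D = dir_const ?d"
  have D1: "1 \<le> D" unfolding D_def by (rule dir_const_ge_1) (simp add: DIM_positive Suc_leI)
  obtain M' where M': "0 \<le> M'" "\<And>n. coverable ?K (1 / 2 ^ n) (M' * 2 ^ (n * ?d))"
    using coverable_cball by metis
  define M where "M = M' * 2 ^ (2 * L * ?d)"
  have M: "coverable ?K (1 / 2 ^ (2 * L)) M" "0 \<le> M"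
    using M' by (auto simp: M_def)
  \<comment> \<open>\<open>max 1\<close> keeps the logarithm meaningful if the ball is null.\<close>
  define H where "H = log 2 (max 1 (enn2real (\<mu> (cball 0 (R + 1)))))"
  have H: "\<mu> (cball x 1) \<le> ennreal (2 powr H)" if "x \<in> ?K" for x
  proof -
    have "\<mu> (cball x 1) \<le> \<mu> (cball 0 (R + 1))"
      using that by (intro outer_measure_mono[OF \<mu>(1)]) (simp add: cball_subset_cball_iff dist_norm)
    also have "\<dots> = ennreal (enn2real (\<mu> (cball 0 (R + 1))))"
      using outer_measure_bounded_finite[OF \<mu>, of 0 "R + 1"] by simp
    also have "\<dots> \<le> ennreal (2 powr H)" unfolding H_def by (intro ennreal_leI) simp
    finally show ?thesis .
  qed
  define gap where "gap = s - (?d - p * l + log 2 (2 * D) / L)"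
  have gap: "0 < gap" using s by (simp add: gap_def D_def)
  obtain q :: nat where q: "2 * (l * (2 * L + 1) * (?d + 1)) / gap < q"
    using reals_Archimedean2 by blast
  have "0 \<le> 2 * (l * (2 * L + 1) * (?d + 1)) / gap" using gap by simp
  then have q0: "0 < q" using q by (cases q) auto
  \<comment> \<open>The asymptotic proportion of scales that may be lost as not good while masses
    stay above 2^-((d+1) n); q was chosen to keep l \<tau> below \<open>gap\<close>.\<close>
  define \<tau> where "\<tau> = (2 * real L + 1) * (real ?d + 1) / q"
  have \<tau>: "l * \<tau> < gap"
  proof -
    have "2 * (l * (2 * L + 1) * (?d + 1)) < real q * gap"
      using q gap by (simp only: pos_divide_less_eq)
    moreover have "0 \<le> real (l * (2 * L + 1) * (?d + 1))" by (rule of_nat_0_le_iff)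
    ultimately have "real (l * (2 * L + 1) * (?d + 1)) < real q * gap"
      by (simp only: of_nat_mult)
    then show ?thesis using q0 by (simp add: \<tau>_def pos_divide_less_eq algebra_simps)
  qed
  define C where "C = (2 * real L + 1) * (1 + H / q)"
  define \<Gamma> where "\<Gamma> n = (p - \<tau>) * n - C" for n :: nat
  define P where "P = 2 * (D * 2 ^ (L * ?d))"
  have P1: "1 \<le> P"
    using mult_mono[of 1 D 1 "2 ^ (L * ?d)"] D1 by (simp add: P_def)
  \<comment> \<open>By the value of P, the exponent is l \<tau> - gap, hence negative.\<close>
  define b where "b = 2 powr (log 2 P / L - l * (p - \<tau>) - s)"
  \<comment> \<open>The last condition limits the total drop of mass; points violating it infinitely
    often form a null set by \<open>null_frequently_small_balls\<close>.\<close>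
  define A where "A n = {x \<in> ?K. mean_porous_upto l \<alpha> p \<mu> x (1 / 2 ^ q) n \<and>
      \<mu> (cball x (1 / 2 ^ n)) \<le> ennreal (2 powr (- (s * n))) \<and>
      ennreal (2 powr (- ((real ?d + 1) * n))) < \<mu> (cball x (1 / 2 ^ n))}" for n
  have "\<mu> {x. \<exists>\<^sub>F n in sequentially. x \<in> A n} = 0"
  proof (rule borel_cantelli_geometric[OF \<mu>(1)])
    fix n
    have "A n \<subseteq> {x \<in> ?K. \<Gamma> n \<le> card {k \<in> {1..n}. good_scale l \<alpha> \<mu> (1 / 2 ^ q) L x k}}"
    proof
      fix x assume x: "x \<in> A n"
      have "p * n - (2 * real L + 1) * (1 + (H + (real ?d + 1) * n) / q)
          \<le> card {k \<in> {1..n}. good_scale l \<alpha> \<mu> (1 / 2 ^ q) L x k}"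
        by (rule card_good_scales_ge[OF \<mu>(1) q0]) (use x H in \<open>auto simp: A_def\<close>)
      moreover have "p * n - (2 * real L + 1) * (1 + (H + (real ?d + 1) * n) / q) = \<Gamma> n"
        using q0 by (simp add: \<Gamma>_def C_def \<tau>_def field_simps)
      ultimately show "x \<in> {x \<in> ?K. \<Gamma> n \<le> card {k \<in> {1..n}. good_scale l \<alpha> \<mu> (1 / 2 ^ q) L x k}}"
        using x by (simp add: A_def)
    qed
    with coverable_good_scales[OF \<mu>(1) L M]
    have "coverable (A n) (1 / 2 ^ n) (L * (M * P ^ (n div L + 1) * 2 powr (- (l * \<Gamma> n))))"
      unfolding P_def D_def by (rule coverable_mono) auto
    then have "\<mu> (A n) \<le>
        ennreal (L * (M * P ^ (n div L + 1) * 2 powr (- (l * \<Gamma> n))) * 2 powr (- (s * n)))"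
      by (rule outer_measure_coverable[OF \<mu>(1)]) (auto simp: A_def)
    also have "\<dots> \<le> ennreal (L * M * P * 2 powr (l * C) * b ^ n)"
    proof (rule ennreal_leI)
      have "real (n div L * L) \<le> n" unfolding of_nat_le_iff by simp
      then have "real (n div L) \<le> n / L" using L(1) by (simp add: pos_le_divide_eq)
      have "P ^ (n div L + 1) = P * P powr real (n div L)"
        using P1 by (simp add: powr_realpow)
      also have "\<dots> \<le> P * P powr (n / L)"
        using P1 \<open>real (n div L) \<le> n / L\<close> by (intro mult_left_mono powr_mono) auto
      also have "P powr (n / L) = 2 powr (log 2 P / L * n)"
        using P1 by (simp add: powr_def log_def)
      finally have "P ^ (n div L + 1) \<le> P * 2 powr (log 2 P / L * n)" .
      then have "L * (M * P ^ (n div L + 1) * 2 powr (- (l * \<Gamma> n))) * 2 powr (- (s * n))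
        \<le> L * (M * (P * 2 powr (log 2 P / L * n)) * 2 powr (- (l * \<Gamma> n))) * 2 powr (- (s * n))"
        using M(2) by (intro mult_left_mono mult_right_mono) auto
      also have "\<dots> = L * M * P * (2 powr (log 2 P / L * n) * 2 powr (- (l * \<Gamma> n)) * 2 powr (- (s * n)))"
        by (simp add: mult_ac)
      also have "2 powr (log 2 P / L * n) * 2 powr (- (l * \<Gamma> n)) * 2 powr (- (s * n)) = 2 powr (l * C) * b ^ n"
      proof -
        have "b ^ n = 2 powr ((log 2 P / L - l * (p - \<tau>) - s) * n)"
          by (simp add: b_def powr_power mult.commute)
        then show ?thesis
          by (simp only: powr_add[symmetric] \<Gamma>_def) (simp add: algebra_simps)
      qed
      finally show "L * (M * P ^ (n div L + 1) * 2 powr (- (l * \<Gamma> n))) * 2 powr (- (s * n))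
          \<le> L * M * P * 2 powr (l * C) * b ^ n"
        by (simp add: mult.assoc)
    qed
    finally show "\<mu> (A n) \<le> ennreal (L * M * P * 2 powr (l * C) * b ^ n)" .
  next
    have "log 2 P = log 2 (2 * D) + L * ?d"
    proof -
      have "P = (2 * D) * 2 powr (L * ?d)"
        using powr_realpow[of 2 "L * ?d"] by (simp add: P_def)
      also have "log 2 \<dots> = log 2 (2 * D) + log 2 (2 powr (L * ?d))"
        using D1 by (intro log_mult_pos) auto
      finally show ?thesis by simp
    qed
    then have "log 2 P / L = log 2 (2 * D) / L + ?d"
      using L(1) by (simp add: add_divide_distrib)
    then have "log 2 P / L - l * (p - \<tau>) - s < 0"
      using \<tau> by (simp add: gap_def algebra_simps)
    then show "b < 1" unfolding b_def by (simp add: powr_less_one)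
  qed (use M P1 in \<open>auto simp: b_def\<close>)
  moreover have "\<mu> {x. \<exists>\<^sub>F n in sequentially. \<mu> (cball x (1 / 2 ^ n)) \<le> ennreal (2 powr (- ((real ?d + 1) * n)))} = 0"
    using null_frequently_small_balls[OF \<mu>(1), of "real ?d + 1"] by simp
  moreover have "?F \<inter> ?K \<subseteq> {x. \<exists>\<^sub>F n in sequentially. x \<in> A n} \<union>
      {x. \<exists>\<^sub>F n in sequentially. \<mu> (cball x (1 / 2 ^ n)) \<le> ennreal (2 powr (- ((real ?d + 1) * n)))}"
  proof
    fix x assume x: "x \<in> ?F \<inter> ?K"
    then have "\<exists>\<^sub>F n in sequentially. mean_porous_upto l \<alpha> p \<mu> x (1 / 2 ^ q) n \<and>
        \<mu> (cball x (1 / 2 ^ n)) \<le> ennreal (2 powr (- (s * n)))" by simp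
    then have "\<exists>\<^sub>F n in sequentially. x \<in> A n \<or>
        \<mu> (cball x (1 / 2 ^ n)) \<le> ennreal (2 powr (- ((real ?d + 1) * n)))"
    proof (rule frequently_elim1)
      fix n assume "mean_porous_upto l \<alpha> p \<mu> x (1 / 2 ^ q) n \<and>
        \<mu> (cball x (1 / 2 ^ n)) \<le> ennreal (2 powr (- (s * n)))"
      moreover have "x \<in> ?K" using x by blast
      ultimately show "x \<in> A n \<or> \<mu> (cball x (1 / 2 ^ n)) \<le> ennreal (2 powr (- ((real ?d + 1) * n)))"
        unfolding A_def using not_le by blast
    qed
    then show "x \<in> {x. \<exists>\<^sub>F n in sequentially. x \<in> A n} \<union>
      {x. \<exists>\<^sub>F n in sequentially. \<mu> (cball x (1 / 2 ^ n)) \<le> ennreal (2 powr (- ((real ?d + 1) * n)))}"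
      by (simp only: frequently_disj_iff Un_iff mem_Collect_eq)
  qed
  ultimately show "\<mu> (?F \<inter> ?K) = 0"
    by (rule outer_measure_null_subset_Un[OF \<mu>(1)])
qed

subsection \<open>Local dimensions\<close>

lemma loc_dim_quotient_less:
  assumes "0 < r" "r < 1" "\<mu> (cball x r) < \<infinity>" "ereal s < loc_dim_quotient \<mu> x r"
  shows "\<mu> (cball x r) \<le> ennreal (r powr s)"
proof (cases "\<mu> (cball x r) = 0")
  case False
  define m where "m = enn2real (\<mu> (cball x r))"
  have m: "0 < m" "\<mu> (cball x r) = ennreal m"
    using False assms(3) by (auto simp: m_def enn2real_positive_iff zero_less_iff_neq_zero)
  have "log 2 r < 0" using assms(1,2) by (simp add: log_less_zero_cancel_iff)
  moreover have "s < log 2 m / log 2 r"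
    using assms(4) False by (simp add: loc_dim_quotient_def m_def)
  ultimately have "log 2 m \<le> log 2 r * s"
    by (simp add: neg_less_divide_eq mult.commute)
  then have "m \<le> 2 powr (log 2 r * s)"
    using m(1) by (simp add: log_le_iff)
  also have "\<dots> = r powr s"
    using assms(1) by (simp flip: powr_powr)
  finally show ?thesis unfolding m(2) by (rule ennreal_leI)
qed simp

lemma eventually_small_balls:
  assumes "\<And>r. \<mu> (cball x r) < \<infinity>" "ereal s < lower_loc_dim \<mu> x"
  shows "\<forall>\<^sub>F n in sequentially. \<mu> (cball x (1 / 2 ^ n)) \<le> ennreal (2 powr (- (s * n)))"
proof -
  have "\<forall>\<^sub>F r in at_right 0. ereal s < loc_dim_quotient \<mu> x r"
    using assms(2) unfolding lower_loc_dim_def by (rule less_LiminfD)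
  moreover have "filterlim (\<lambda>n. 1 / 2 ^ n :: real) (at_right 0) sequentially"
    by (intro tendsto_imp_filterlim_at_right) (auto intro!: LIMSEQ_divide_realpow_zero)
  ultimately have "\<forall>\<^sub>F n in sequentially. ereal s < loc_dim_quotient \<mu> x (1 / 2 ^ n)"
    by (rule eventually_compose_filterlim)
  moreover have "\<forall>\<^sub>F n in sequentially. (0::nat) < n" by (rule eventually_gt_at_top)
  ultimately show ?thesis
  proof eventually_elim
    case (elim n)
    then have "(1::real) < 2 ^ n" by (intro one_less_power) auto
    then have "\<mu> (cball x (1 / 2 ^ n)) \<le> ennreal ((1 / 2 ^ n) powr s)"
      using elim assms(1) by (intro loc_dim_quotient_less) (auto simp: divide_simps)
    moreover have "1 / 2 ^ n = 2 powr (- real n)"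
      by (simp add: powr_minus_divide powr_realpow)
    then have "(1 / 2 ^ n) powr s = 2 powr (- (s * n))"
      by (simp add: powr_powr mult.commute)
    ultimately show ?case by simp
  qed
qed

text \<open>The upper limit is approached along arbitrary radii r. Rounding r down to a power of 1/2
  loses a factor 2^s, which passing from s to t < s absorbs once n is large.\<close>

lemma frequently_small_balls:
  assumes fin: "\<And>r. \<mu> (cball x r) < \<infinity>" and mono: "\<And>A B. A \<subseteq> B \<Longrightarrow> \<mu> A \<le> \<mu> B"
    and s: "ereal s < upper_loc_dim \<mu> x" and t: "0 < t" "t < s"
  shows "\<exists>\<^sub>F n in sequentially. \<mu> (cball x (1 / 2 ^ n)) \<le> ennreal (2 powr (- (t * n)))"
  unfolding frequently_sequentially
proof
  fix m
  \<comment> \<open>n \<ge> s / (s - t) is what turns (1 - n) s into at most - t n.\<close>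
  define m' where "m' = max m (nat \<lceil>s / (s - t)\<rceil>)"
  have freq: "\<exists>\<^sub>F r in at_right 0. ereal s < loc_dim_quotient \<mu> x r"
  proof (rule ccontr)
    assume "\<not> ?thesis"
    then have "\<forall>\<^sub>F r in at_right 0. loc_dim_quotient \<mu> x r \<le> ereal s"
      by (simp add: not_frequently not_less)
    then show False using Limsup_bounded s unfolding upper_loc_dim_def by (metis leD)
  qed
  have "\<forall>\<^sub>F r in at_right (0::real). 0 < r \<and> r < 1 / 2 ^ m'"
    unfolding eventually_at_right_field by (intro exI[of _ "1 / 2 ^ m'"]) auto
  from frequently_ex[OF frequently_eventually_frequently[OF freq this]]
  obtain r where r: "ereal s < loc_dim_quotient \<mu> x r" "0 < r" "r < 1 / 2 ^ m'" by blast
  have "\<exists>n. (1 / 2) ^ n < r" by (rule real_arch_pow_inv) (use r in auto)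
  then have ex: "\<exists>n. 1 / 2 ^ n \<le> r" by (auto simp: power_one_over intro: less_imp_le)
  define n where "n = (LEAST n. 1 / 2 ^ n \<le> r)"
  have n: "1 / 2 ^ n \<le> r" unfolding n_def using ex by (rule LeastI_ex)
  have "m' < n"
  proof (rule ccontr)
    assume "\<not> m' < n"
    then have "(1::real) / 2 ^ m' \<le> 1 / 2 ^ n"
      by (intro divide_left_mono power_increasing) auto
    then show False using n r by linarith
  qed
  then have "\<not> 1 / 2 ^ (n - 1) \<le> r"
    using not_less_Least[of "n - 1" "\<lambda>n. 1 / 2 ^ n \<le> r"] by (simp add: n_def)
  moreover have "1 / 2 ^ (n - 1) = 2 powr (1 - real n)"
    using \<open>m' < n\<close> powr_minus_divide[of 2 "real (n - 1)"] powr_realpow[of 2 "n - 1"]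
    by (simp add: of_nat_diff)
  ultimately have rn: "r \<le> 2 powr (1 - real n)" by linarith
  have "(1::real) \<le> 2 ^ m'" by simp
  then have "1 / 2 ^ m' \<le> (1::real)" by (simp add: divide_simps)
  then have "r < 1" using r by linarith
  have "s / (s - t) \<le> n" using \<open>m' < n\<close> unfolding m'_def by linarith
  then have "s \<le> n * (s - t)" using t by (simp add: pos_divide_le_eq)
  then have e: "(1 - real n) * s \<le> - (t * n)" by (simp add: algebra_simps)
  have "\<mu> (cball x (1 / 2 ^ n)) \<le> \<mu> (cball x r)"
    by (intro mono subset_cball n)
  also have "\<dots> \<le> ennreal (r powr s)"
    by (rule loc_dim_quotient_less[OF r(2) \<open>r < 1\<close> fin r(1)])
  also have "\<dots> \<le> ennreal (2 powr (- (t * n)))"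
  proof (rule ennreal_leI)
    have "r powr s \<le> (2 powr (1 - real n)) powr s"
      using rn r t by (intro powr_mono2) auto
    also have "\<dots> \<le> 2 powr (- (t * n))"
      unfolding powr_powr using e by (intro powr_mono) auto
    finally show "r powr s \<le> 2 powr (- (t * n))" .
  qed
  finally show "\<exists>n\<ge>m. \<mu> (cball x (1 / 2 ^ n)) \<le> ennreal (2 powr (- (t * n)))"
    using \<open>m' < n\<close> by (intro exI[of _ n]) (auto simp: m'_def)
qed

lemma null_frequently_porous_of_gt:
  fixes \<mu> :: "'a::euclidean_space set \<Rightarrow> ennreal" and s p \<alpha> :: real
  assumes \<mu>: "outer_measure_space UNIV \<mu>" "locally_finite \<mu>"
    and \<alpha>: "0 < \<alpha>" "\<alpha> < 1 / 2" and p: "p \<le> 1" and l: "l \<le> DIM('a)"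
    and s: "DIM('a) - p * l + 4 * (log 2 (2 * dir_const DIM('a)) + DIM('a)) / log 2 (1 / (1 - 2 * \<alpha>)) < s"
  shows "\<mu> {x. \<forall>\<epsilon>>0. \<exists>\<^sub>F n in sequentially.
    mean_porous_upto l \<alpha> p \<mu> x \<epsilon> n \<and> \<mu> (cball x (1 / 2 ^ n)) \<le> ennreal (2 powr (- (s * n)))} = 0"
    (is "\<mu> ?F = 0")
proof -
  let ?d = "DIM('a)"
  define B where "B = log 2 (2 * dir_const ?d)"
  have "1 \<le> dir_const ?d" by (rule dir_const_ge_1) (simp add: DIM_positive Suc_leI)
  then have B: "0 \<le> B" unfolding B_def by simp
  define X where "X = log 2 (1 / (1 - 2 * \<alpha>))"
  have X: "0 < X" using \<alpha> by (simp add: X_def divide_simps)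
  have X\<alpha>: "1 - 2 * \<alpha> = 2 powr - X"
    using \<alpha> by (simp add: X_def powr_minus_divide)
  show ?thesis
  proof (cases "X < 4")
    \<comment> \<open>No admissible block length, but 4 d / X > d \<ge> p l already forces s > d.
      The summand \<open>DIM('a)\<close> in the constant is there for this case.\<close>
    case True
    have "p * l \<le> 1 * real ?d" using p l by (intro mult_mono) auto
    also have "real ?d \<le> 4 * (B + ?d) / X"
    proof -
      have "real ?d * X \<le> real ?d * 4" using True by (intro mult_left_mono) auto
      also have "\<dots> \<le> 4 * (B + ?d)" using B by simp
      finally show ?thesis using X by (simp only: pos_le_divide_eq)
    qed
    finally have "?d < s" using s by (simp add: B_def X_def)
    then have "\<mu> {x. \<exists>\<^sub>F n in sequentially. \<mu> (cball x (1 / 2 ^ n)) \<le> ennreal (2 powr (- (s * n)))} = 0"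
      by (rule null_frequently_small_balls[OF \<mu>(1)])
    moreover have "?F \<subseteq> {x. \<exists>\<^sub>F n in sequentially. \<mu> (cball x (1 / 2 ^ n)) \<le> ennreal (2 powr (- (s * n)))}"
    proof
      fix x assume "x \<in> ?F"
      then have "\<exists>\<^sub>F n in sequentially. mean_porous_upto l \<alpha> p \<mu> x 1 n \<and>
          \<mu> (cball x (1 / 2 ^ n)) \<le> ennreal (2 powr (- (s * n)))" by simp
      then show "x \<in> {x. \<exists>\<^sub>F n in sequentially. \<mu> (cball x (1 / 2 ^ n)) \<le> ennreal (2 powr (- (s * n)))}"
        by (auto elim: frequently_elim1)
    qed
    ultimately show ?thesis by (rule outer_measure_null_subset[OF \<mu>(1)])
  next
    case False
    \<comment> \<open>L \<le> X / 2 gives 1 - 2 \<alpha> = 2^-X \<le> 4^-L; rounding down keeps L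
      \<ge> X / 4 because X \<ge> 4, hence the factor 4 in the constant.\<close>
    define L where "L = nat \<lfloor>X / 2\<rfloor>"
    have L: "2 \<le> L" "2 * real L \<le> X" "X / 4 \<le> L" using False unfolding L_def by linarith+
    show ?thesis
    proof (rule null_frequently_porous[OF \<mu> L(1) _ l])
      have "2 powr - X \<le> 2 powr - real (2 * L)" using L(2) by (intro powr_mono) auto
      also have "\<dots> = 1 / 4 ^ L"
        using powr_minus_divide[of 2 "real (2 * L)"] powr_realpow[of 2 "2 * L"]
        by (simp add: power_mult)
      finally show "1 - 2 * \<alpha> \<le> 1 / 4 ^ L" by (simp add: X\<alpha>)
      have "B / L \<le> B / (X / 4)" using B X L(3) by (intro divide_left_mono) auto
      also have "\<dots> \<le> 4 * (B + ?d) / X" using X by (simp add: divide_simps)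
      finally show "?d - p * l + log 2 (2 * dir_const ?d) / L < s"
        using s unfolding B_def[symmetric] X_def[symmetric] by linarith
    qed
  qed
qed

theorem theorem1p3:
  shows "\<exists>c::real. \<forall>(\<alpha>::real) (p::real) (l::nat) (\<mu> :: (real ^ 'n::finite) set \<Rightarrow> ennreal).
    0 < \<alpha> \<and> \<alpha> < 1 / 2 \<and> 0 < p \<and> p \<le> 1 \<and> l \<in> {1..CARD('n)} \<and> gmt_measure \<mu> \<longrightarrow>
      \<mu> {x \<in> lower_mean_porous_set l \<alpha> p \<mu>.
           \<not> upper_loc_dim \<mu> x
               \<le> ereal (real CARD('n) - p * real l + c / log 2 (1 / (1 - 2 * \<alpha>)))} = 0 \<and>
      \<mu> {x \<in> upper_mean_porous_set l \<alpha> p \<mu>.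
           \<not> lower_loc_dim \<mu> x
               \<le> ereal (real CARD('n) - p * real l + c / log 2 (1 / (1 - 2 * \<alpha>)))} = 0"
proof -
  let ?d = "CARD('n)"
  define c where "c = 4 * (log 2 (2 * dir_const ?d) + ?d)"
  have "1 \<le> dir_const ?d" by (rule dir_const_ge_1) (simp add: Suc_leI)
  then have "0 \<le> log 2 (2 * dir_const ?d)" by simp
  then have c: "0 < c" unfolding c_def by (simp add: add_nonneg_pos)
  show ?thesis
  proof (intro exI[of _ c] allI impI)
    fix \<alpha> p :: real and l :: nat and \<mu> :: "(real ^ 'n) set \<Rightarrow> ennreal"
    assume *: "0 < \<alpha> \<and> \<alpha> < 1 / 2 \<and> 0 < p \<and> p \<le> 1 \<and> l \<in> {1..CARD('n)} \<and> gmt_measure \<mu>"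
    then have \<mu>: "outer_measure_space UNIV \<mu>" "locally_finite \<mu>"
      by (auto simp: gmt_measure_def)
    have fin: "\<mu> (cball x r) < \<infinity>" for x r by (rule outer_measure_bounded_finite[OF \<mu>])
    define S where "S = real CARD('n) - p * real l + c / log 2 (1 / (1 - 2 * \<alpha>))"
    have "0 < log 2 (1 / (1 - 2 * \<alpha>))" using * by (simp add: divide_simps)
    then have "0 < c / log 2 (1 / (1 - 2 * \<alpha>))" using c by simp
    moreover have "p * l \<le> 1 * real ?d" using * by (intro mult_mono) auto
    ultimately have S: "0 < S" by (simp add: S_def)
    \<comment> \<open>Countably many exponents decreasing to S, so that a union of null sets catches
      every dimension above S.\<close>
    define s where "s m = S + 1 / real (Suc m)" for m
    have sS: "S < s m" for m by (simp add: s_def)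
    \<comment> \<open>One set for both claims: porosity eventually with small balls frequently, or
      the reverse, makes both hold together frequently.\<close>
    define F where "F m = {x. \<forall>\<epsilon>>0. \<exists>\<^sub>F n in sequentially. mean_porous_upto l \<alpha> p \<mu> x \<epsilon> n \<and>
      \<mu> (cball x (1 / 2 ^ n)) \<le> ennreal (2 powr (- (s m * n)))}" for m
    have "\<mu> (F m) = 0" for m
      unfolding F_def
      by (rule null_frequently_porous_of_gt[OF \<mu>]) (use * sS[of m] in \<open>auto simp: S_def c_def\<close>)
    then have F0: "\<mu> (\<Union>m. F m) = 0" by (rule outer_measure_null_UN[OF \<mu>(1)])
    have between: "\<exists>m t. s m < t \<and> ereal t < z" if z: "\<not> z \<le> ereal S" for z
    proof -
      have "ereal S < z" using z by (simp add: not_le)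
      then obtain t where t: "ereal S < ereal t" "ereal t < z" using ereal_dense2 by blast
      then obtain m where "inverse (real (Suc m)) < t - S" using reals_Archimedean[of "t - S"] by auto
      then show ?thesis using t(2) by (intro exI[of _ m] exI[of _ t]) (simp add: s_def inverse_eq_divide)
    qed
    have "{x \<in> lower_mean_porous_set l \<alpha> p \<mu>. \<not> upper_loc_dim \<mu> x \<le> ereal S} \<subseteq> (\<Union>m. F m)"
    proof
      fix x assume x: "x \<in> {x \<in> lower_mean_porous_set l \<alpha> p \<mu>. \<not> upper_loc_dim \<mu> x \<le> ereal S}"
      then obtain m t where t: "s m < t" "ereal t < upper_loc_dim \<mu> x" using between by blast
      have "0 < s m" using S sS[of m] by linarith
      then have small: "\<exists>\<^sub>F n in sequentially. \<mu> (cball x (1 / 2 ^ n)) \<le> ennreal (2 powr (- (s m * n)))"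
        using fin outer_measure_mono[OF \<mu>(1)] t by (intro frequently_small_balls) auto
      have "\<exists>\<^sub>F n in sequentially. mean_porous_upto l \<alpha> p \<mu> x \<epsilon> n \<and>
          \<mu> (cball x (1 / 2 ^ n)) \<le> ennreal (2 powr (- (s m * n)))" if "0 < \<epsilon>" for \<epsilon>
      proof -
        have "\<forall>\<^sub>F n in sequentially. mean_porous_upto l \<alpha> p \<mu> x \<epsilon> n"
          using x that by (simp add: lower_mean_porous_set_def)
        from frequently_eventually_frequently[OF small this] show ?thesis
          by (rule frequently_elim1) blast
      qed
      then have "x \<in> F m" by (simp add: F_def)
      then show "x \<in> (\<Union>m. F m)" by blast
    qed
    moreover have "{x \<in> upper_mean_porous_set l \<alpha> p \<mu>. \<not> lower_loc_dim \<mu> x \<le> ereal S} \<subseteq> (\<Union>m. F m)"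
    proof
      fix x assume x: "x \<in> {x \<in> upper_mean_porous_set l \<alpha> p \<mu>. \<not> lower_loc_dim \<mu> x \<le> ereal S}"
      then obtain m t where t: "s m < t" "ereal t < lower_loc_dim \<mu> x" using between by blast
      then have "ereal (s m) < lower_loc_dim \<mu> x" by (meson less_ereal.simps(1) less_trans)
      then have "\<forall>\<^sub>F n in sequentially. \<mu> (cball x (1 / 2 ^ n)) \<le> ennreal (2 powr (- (s m * n)))"
        by (intro eventually_small_balls fin)
      moreover have "\<exists>\<^sub>F n in sequentially. mean_porous_upto l \<alpha> p \<mu> x \<epsilon> n" if "0 < \<epsilon>" for \<epsilon>
        using x that by (simp add: upper_mean_porous_set_def)
      ultimately have "x \<in> F m"
        by (auto simp: F_def dest: frequently_eventually_frequently)
      then show "x \<in> (\<Union>m. F m)" by blast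
    qed
    ultimately show "\<mu> {x \<in> lower_mean_porous_set l \<alpha> p \<mu>.
           \<not> upper_loc_dim \<mu> x
               \<le> ereal (real CARD('n) - p * real l + c / log 2 (1 / (1 - 2 * \<alpha>)))} = 0 \<and>
      \<mu> {x \<in> upper_mean_porous_set l \<alpha> p \<mu>.
           \<not> lower_loc_dim \<mu> x
               \<le> ereal (real CARD('n) - p * real l + c / log 2 (1 / (1 - 2 * \<alpha>)))} = 0"
      unfolding S_def[symmetric] by (blast intro: outer_measure_null_subset[OF \<mu>(1) F0])
  qed
qed

end
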